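(* Let $\Phi,\Psi$ be two finite simplicial graphs and $\rho:C(\Phi)\hookrightarrow C(\Psi)$ an injective morphism. Assume that $\Psi$ is triangle-free and that $\Phi$ has no isolated vertex. Then there exists an automorphism $\alpha\in\mathrm{Aut}(C(\Phi))$ such that $\rho\circ\alpha:C(\Phi)\hookrightarrow C(\Psi)$ is a peripheral embedding.
   Context: Given a simplicial graph $\Gamma$, $C(\Gamma)=\langle u\in V(\Gamma)\mid u^2=1\ (u\in V(\Gamma)),\ [u,v]=1 \text{ if } \{u,v\}\in E(\Gamma)\rangle$ is the right-angled Coxeter group. $X(\Gamma)$ is the CAT(0) cube complex whose one-skeleton is the Cayley graph of $C(\Gamma)$ with respect to $V(\Gamma)$ and whose $n$-cubes fill in the subgraphs isomorphic to one-skeleta of $n$-cubes. A hyperplane is an equivalence class of edges for the equivalence relation generated by identifying opposite edges of squares; removing the interiors of the edges dual to (i.e. in) $J$ from the one-skeleton leaves two components, the halfspaces delimited by $J$. Two distinct hyperplanes are transverse if some square contains edges dual to each. $J$ separates the vertex $1$ from another hyperplane $K$ if $J\neq K$ are not transverse and $K$ lies in the halfspace delimited by $J$ not containing $1$. A collection of hyperplanes is peripheral if none of its hyperplanes separates another one from $1$. A reflection is a conjugate $gug^{-1}$ of a generator $u$; it is the reflection along the hyperplane containing the edge $\{g,gu\}$ (it inverts every edge dual to it). A peripheral embedding is a morphism $C(\Phi)\to C(\Psi)$ sending the generators of $C(\Phi)$ to pairwise distinct reflections along a peripheral collection of hyperplanes of $X(\Psi)$. *)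

theory Defs
  imports "HOL-Algebra.Bij"
begin

section \<open>Simplicial graphs\<close>

record 'a graph =
  verts :: "'a set"
  edges :: "'a set set"

definition simplicial_graph :: "'a graph \<Rightarrow> bool" where
  "simplicial_graph \<Gamma> \<longleftrightarrow>
     edges \<Gamma> \<subseteq> {{u, v} | u v. u \<in> verts \<Gamma> \<and> v \<in> verts \<Gamma> \<and> u \<noteq> v}"

definition finite_simplicial_graph :: "'a graph \<Rightarrow> bool" where
  "finite_simplicial_graph \<Gamma> \<longleftrightarrow> simplicial_graph \<Gamma> \<and> finite (verts \<Gamma>)"

definition triangle_free :: "'a graph \<Rightarrow> bool" where
  "triangle_free \<Gamma> \<longleftrightarrow>
     \<not> (\<exists>u v w. {u, v} \<in> edges \<Gamma> \<and> {v, w} \<in> edges \<Gamma> \<and> {u, w} \<in> edges \<Gamma>)"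

definition isolated_vertex :: "'a graph \<Rightarrow> 'a \<Rightarrow> bool" where
  "isolated_vertex \<Gamma> v \<longleftrightarrow> v \<in> verts \<Gamma> \<and> \<not> (\<exists>w. {v, w} \<in> edges \<Gamma>)"


section \<open>Group presentations\<close>

text \<open>The letter \<open>(x, True)\<close> stands for \<open>x\<close>, the letter \<open>(x, False)\<close> for its formal inverse.\<close>

type_synonym 'a word = "('a \<times> bool) list"

definition words :: "'a set \<Rightarrow> 'a word set" where
  "words X = lists (X \<times> UNIV)"

text \<open>Deletion of a subword that is a relator or consists of two mutually inverse letters.\<close>

inductive word_step :: "'a set \<Rightarrow> 'a word set \<Rightarrow> 'a word \<Rightarrow> 'a word \<Rightarrow> bool" for X R where
  cancel: "\<lbrakk>a \<in> words X; b \<in> words X; x \<in> X\<rbrakk>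
             \<Longrightarrow> word_step X R (a @ [(x, s), (x, \<not> s)] @ b) (a @ b)"
| relator: "\<lbrakk>a \<in> words X; b \<in> words X; r \<in> R\<rbrakk> \<Longrightarrow> word_step X R (a @ r @ b) (a @ b)"

definition word_rel :: "'a set \<Rightarrow> 'a word set \<Rightarrow> 'a word rel" where
  "word_rel X R = {(v, w). v \<in> words X \<and> w \<in> words X \<and> equivclp (word_step X R) v w}"

definition presented_group :: "'a set \<Rightarrow> 'a word set \<Rightarrow> 'a word set monoid" where
  "presented_group X R =
     \<lparr>carrier = words X // word_rel X R,
      mult = (\<lambda>A B. \<Union>a\<in>A. \<Union>b\<in>B. word_rel X R `` {a @ b}),
      one = word_rel X R `` {[]}\<rparr>"


section \<open>Right-angled Coxeter groups\<close>

definition racg_relators :: "'a graph \<Rightarrow> 'a word set" where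
  "racg_relators \<Gamma> =
     {[(u, True), (u, True)] | u. u \<in> verts \<Gamma>} \<union>
     {[(u, True), (v, True), (u, False), (v, False)] | u v.
        u \<in> verts \<Gamma> \<and> v \<in> verts \<Gamma> \<and> {u, v} \<in> edges \<Gamma>}"

definition racg :: "'a graph \<Rightarrow> 'a word set monoid" where
  "racg \<Gamma> = presented_group (verts \<Gamma>) (racg_relators \<Gamma>)"

definition gen :: "'a graph \<Rightarrow> 'a \<Rightarrow> 'a word set" where
  "gen \<Gamma> u = word_rel (verts \<Gamma>) (racg_relators \<Gamma>) `` {[(u, True)]}"


section \<open>Hyperplanes\<close>

text \<open>
  Hyperplanes and their halfspaces are determined by the 2-skeleton of the cube complex
  \<open>X(\<Gamma>)\<close>: its edges are those of the Cayley graph and its squares the 4-cycles of the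
  Cayley graph. A hyperplane is a set of edges, a halfspace is given by its set of vertices.
\<close>

definition cayley_edges :: "'a graph \<Rightarrow> 'a word set set set" where
  "cayley_edges \<Gamma> =
     {{g, g \<otimes>\<^bsub>racg \<Gamma>\<^esub> gen \<Gamma> u} | g u. g \<in> carrier (racg \<Gamma>) \<and> u \<in> verts \<Gamma>}"

definition square :: "'a graph \<Rightarrow> 'a word set \<Rightarrow> 'a word set \<Rightarrow> 'a word set \<Rightarrow> 'a word set \<Rightarrow> bool"
  where "square \<Gamma> a b c d \<longleftrightarrow>
     distinct [a, b, c, d] \<and> {{a, b}, {b, c}, {c, d}, {d, a}} \<subseteq> cayley_edges \<Gamma>"

definition opposite :: "'a graph \<Rightarrow> 'a word set set \<Rightarrow> 'a word set set \<Rightarrow> bool" where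
  "opposite \<Gamma> e f \<longleftrightarrow> (\<exists>a b c d. square \<Gamma> a b c d \<and> e = {a, b} \<and> f = {c, d})"

definition hyperplanes :: "'a graph \<Rightarrow> 'a word set set set set" where
  "hyperplanes \<Gamma> = {{f \<in> cayley_edges \<Gamma>. equivclp (opposite \<Gamma>) e f} | e. e \<in> cayley_edges \<Gamma>}"

definition transverse :: "'a graph \<Rightarrow> 'a word set set set \<Rightarrow> 'a word set set set \<Rightarrow> bool" where
  "transverse \<Gamma> J K \<longleftrightarrow> J \<noteq> K \<and>
     (\<exists>a b c d. square \<Gamma> a b c d \<and>
        (\<exists>e \<in> {{a, b}, {b, c}, {c, d}, {d, a}}. e \<in> J) \<and>
        (\<exists>f \<in> {{a, b}, {b, c}, {c, d}, {d, a}}. f \<in> K))"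

text \<open>The connected components of the Cayley graph deprived of the edges in \<open>J\<close>.\<close>

definition halfspaces :: "'a graph \<Rightarrow> 'a word set set set \<Rightarrow> 'a word set set set" where
  "halfspaces \<Gamma> J =
     {{h \<in> carrier (racg \<Gamma>). (\<lambda>x y. {x, y} \<in> cayley_edges \<Gamma> - J)\<^sup>*\<^sup>* g h} | g.
        g \<in> carrier (racg \<Gamma>)}"

definition separates_from_one ::
  "'a graph \<Rightarrow> 'a word set set set \<Rightarrow> 'a word set set set \<Rightarrow> bool" where
  "separates_from_one \<Gamma> J K \<longleftrightarrow> J \<noteq> K \<and> \<not> transverse \<Gamma> J K \<and>
     (\<exists>H \<in> halfspaces \<Gamma> J. \<one>\<^bsub>racg \<Gamma>\<^esub> \<notin> H \<and> \<Union>K \<subseteq> H)"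

definition peripheral :: "'a graph \<Rightarrow> 'a word set set set set \<Rightarrow> bool" where
  "peripheral \<Gamma> \<J> \<longleftrightarrow>
     \<J> \<subseteq> hyperplanes \<Gamma> \<and> (\<forall>J\<in>\<J>. \<forall>K\<in>\<J>. \<not> separates_from_one \<Gamma> J K)"


section \<open>Reflections and peripheral embeddings\<close>

definition reflection_along :: "'a graph \<Rightarrow> 'a word set \<Rightarrow> 'a word set set set \<Rightarrow> bool" where
  "reflection_along \<Gamma> r J \<longleftrightarrow> J \<in> hyperplanes \<Gamma> \<and>
     (\<exists>g \<in> carrier (racg \<Gamma>). \<exists>u \<in> verts \<Gamma>.
        r = g \<otimes>\<^bsub>racg \<Gamma>\<^esub> gen \<Gamma> u \<otimes>\<^bsub>racg \<Gamma>\<^esub> inv\<^bsub>racg \<Gamma>\<^esub> g \<and>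
        {g, g \<otimes>\<^bsub>racg \<Gamma>\<^esub> gen \<Gamma> u} \<in> J)"

definition reflection :: "'a graph \<Rightarrow> 'a word set \<Rightarrow> bool" where
  "reflection \<Gamma> r \<longleftrightarrow> (\<exists>g \<in> carrier (racg \<Gamma>). \<exists>u \<in> verts \<Gamma>.
     r = g \<otimes>\<^bsub>racg \<Gamma>\<^esub> gen \<Gamma> u \<otimes>\<^bsub>racg \<Gamma>\<^esub> inv\<^bsub>racg \<Gamma>\<^esub> g)"

text \<open>
  A reflection is along exactly one hyperplane, so the collection of hyperplanes below
  contains one hyperplane for each image of a generator.
\<close>

definition peripheral_embedding ::
  "'a graph \<Rightarrow> 'b graph \<Rightarrow> ('a word set \<Rightarrow> 'b word set) \<Rightarrow> bool" where
  "peripheral_embedding \<Phi> \<Psi> \<phi> \<longleftrightarrow>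
     \<phi> \<in> hom (racg \<Phi>) (racg \<Psi>) \<and>
     (\<forall>u \<in> verts \<Phi>. reflection \<Psi> (\<phi> (gen \<Phi> u))) \<and>
     inj_on (\<lambda>u. \<phi> (gen \<Phi> u)) (verts \<Phi>) \<and>
     peripheral \<Psi> {J. \<exists>u \<in> verts \<Phi>. reflection_along \<Psi> (\<phi> (gen \<Phi> u)) J}"


section \<open>Presented groups are groups\<close>

lemma words_append [simp]: "a @ b \<in> words X \<longleftrightarrow> a \<in> words X \<and> b \<in> words X"
  by (auto simp: words_def)

lemma words_Nil [simp]: "[] \<in> words X"
  by (simp add: words_def)

lemma equiv_word_rel: "equiv (words X) (word_rel X R)"
  unfolding word_rel_def
  by (rule equivI)
     (auto simp: refl_on_def sym_def trans_def intro: equivclp_sym equivclp_trans)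

lemma word_step_context:
  assumes "word_step X R v w" "a \<in> words X" "b \<in> words X"
  shows "word_step X R (a @ v @ b) (a @ w @ b)"
  using assms(1)
proof cases
  case (cancel a' b' x s)
  then show ?thesis
    using word_step.cancel[of "a @ a'" X "b' @ b" x R s] assms by simp
next
  case (relator a' b' r)
  then show ?thesis
    using word_step.relator[of "a @ a'" X "b' @ b" r R] assms by simp
qed

lemma equivclp_word_step_context:
  assumes "equivclp (word_step X R) v w" "a \<in> words X" "b \<in> words X"
  shows "equivclp (word_step X R) (a @ v @ b) (a @ w @ b)"
  using assms(1)
proof (induction rule: equivclp_induct)
  case base
  show ?case by simp
next
  case (step y z)
  then show ?case
    using word_step_context[OF _ assms(2,3)] by (meson equivclp_into_equivclp)
qed

lemma word_rel_append:
  assumes "(a, a') \<in> word_rel X R" "(b, b') \<in> word_rel X R"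
  shows "(a @ b, a' @ b') \<in> word_rel X R"
proof -
  have "equivclp (word_step X R) ([] @ a @ b) ([] @ a' @ b)"
    using assms by (intro equivclp_word_step_context) (auto simp: word_rel_def)
  moreover have "equivclp (word_step X R) (a' @ b @ []) (a' @ b' @ [])"
    using assms by (intro equivclp_word_step_context) (auto simp: word_rel_def)
  ultimately show ?thesis
    using assms by (auto simp: word_rel_def intro: equivclp_trans)
qed

lemma presented_group_mult:
  assumes "a \<in> words X" "b \<in> words X"
  shows "word_rel X R `` {a} \<otimes>\<^bsub>presented_group X R\<^esub> word_rel X R `` {b} = word_rel X R `` {a @ b}"
proof -
  have "congruent2 (word_rel X R) (word_rel X R) (\<lambda>a b. word_rel X R `` {a @ b})"
    unfolding congruent2_def split_paired_all
    by (intro ballI, clarify, intro equiv_class_eq[OF equiv_word_rel] word_rel_append)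
  from UN_equiv_class2[OF equiv_word_rel equiv_word_rel this assms] show ?thesis
    by (simp add: presented_group_def)
qed

lemma word_rel_inverse:
  assumes "w \<in> words X"
  shows "(rev (map (\<lambda>(x, s). (x, \<not> s)) w) @ w, []) \<in> word_rel X R"
  using assms
proof (induction w)
  case Nil
  show ?case by (simp add: word_rel_def)
next
  case (Cons l w)
  obtain x s where l: "l = (x, s)" by (cases l)
  let ?i = "rev (map (\<lambda>(x, s). (x, \<not> s)) w)"
  have x: "x \<in> X" and w: "w \<in> words X" and i: "?i \<in> words X"
    using Cons.prems l by (auto simp: words_def lists_eq_set)
  have "word_step X R (?i @ [(x, \<not> s), (x, \<not> \<not> s)] @ w) (?i @ w)"
    by (rule word_step.cancel) (use x w i in auto)
  moreover have "?i @ [(x, \<not> s), (x, s)] @ w \<in> words X"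
    using x w i by (auto simp: words_def)
  ultimately have "(?i @ [(x, \<not> s), (x, s)] @ w, ?i @ w) \<in> word_rel X R"
    using w i by (auto simp: word_rel_def intro: r_into_equivclp)
  then show ?case
    using Cons.IH[OF w] l by (auto simp: word_rel_def intro: equivclp_trans)
qed

lemma group_presented_group: "group (presented_group X R)"
proof (rule groupI)
  let ?G = "presented_group X R"
  let ?c = "\<lambda>w. word_rel X R `` {w}"
  have carr: "carrier ?G = ?c ` words X" and one: "\<one>\<^bsub>?G\<^esub> = ?c []"
    by (auto simp: presented_group_def quotient_def)
  show "\<one>\<^bsub>?G\<^esub> \<in> carrier ?G"
    by (auto simp: carr one)
  fix A assume A: "A \<in> carrier ?G"
  then obtain a where a: "A = ?c a" "a \<in> words X" by (auto simp: carr)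
  show "\<one>\<^bsub>?G\<^esub> \<otimes>\<^bsub>?G\<^esub> A = A"
    using a by (simp add: one presented_group_mult)
  let ?i = "rev (map (\<lambda>(x, s). (x, \<not> s)) a)"
  have i: "?i \<in> words X"
    using a by (auto simp: words_def lists_eq_set)
  have "?c ?i \<otimes>\<^bsub>?G\<^esub> A = \<one>\<^bsub>?G\<^esub>"
    using equiv_class_eq[OF equiv_word_rel word_rel_inverse[OF a(2)]] a(2)
    by (simp only: a(1) one presented_group_mult[OF i a(2)])
  then show "\<exists>B \<in> carrier ?G. B \<otimes>\<^bsub>?G\<^esub> A = \<one>\<^bsub>?G\<^esub>"
    using i by (auto simp: carr)
  fix B assume "B \<in> carrier ?G"
  then obtain b where b: "B = ?c b" "b \<in> words X" by (auto simp: carr)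
  show "A \<otimes>\<^bsub>?G\<^esub> B \<in> carrier ?G"
    using a b by (simp add: presented_group_mult) (simp add: carr)
  fix C assume "C \<in> carrier ?G"
  then obtain c where "C = ?c c" "c \<in> words X" by (auto simp: carr)
  then show "A \<otimes>\<^bsub>?G\<^esub> B \<otimes>\<^bsub>?G\<^esub> C = A \<otimes>\<^bsub>?G\<^esub> (B \<otimes>\<^bsub>?G\<^esub> C)"
    using a b by (simp add: presented_group_mult)
qed

lemma group_racg: "group (racg \<Gamma>)"
  by (simp add: racg_def group_presented_group)

end

theory Submission
  imports Defs
begin

text \<open>
  Involutions of a right-angled Coxeter group of a triangle-free graph are reflections or products of
  two commuting reflections, and the latter have centralizers of order four. So a generator not sent
  to a reflection is a leaf of \<open>\<Phi>\<close>, attached to a generator sent to a reflection, and a transvection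
  repairs it. Among the automorphisms \<open>\<alpha>\<close> for which all generators are sent to reflections, choose
  one that minimises the sum of the distances from \<open>1\<close> to the hyperplanes. If the hyperplane of \<open>u\<close>
  still separated \<open>1\<close> from that of \<open>w\<close>, then it would separate \<open>1\<close> from the hyperplanes of the whole
  component of \<open>w\<close> outside the star of \<open>u\<close>, and the partial conjugation of this component by \<open>u\<close>
  would decrease the sum.
\<close>

section \<open>Walls of a right-angled reflection group\<close>

text \<open>A hyperplane is represented by its reflection, and the side of a vertex by the predicate
  \<open>sep\<close>, a cocycle under multiplication. Right-angledness enters through
  \<open>infinite_dihedral\<close>: it makes any two descents of one element commute, and this
  replaces normal forms and produces the strips of squares along a wall. The transvection works
  because the image of a neighbour, being neither trivial nor the product of the two commuting
  reflections, must be one of the factors, so multiplying by it leaves the other factor. In the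
  second stage a whole component has to be moved because adjacent generators must go on commuting;
  edges into the link of \<open>u\<close> do no harm, since \<open>u\<close> commutes with its
  link.\<close>

context group
begin

section \<open>Conjugation and involutions in an arbitrary group\<close>

definition conjugate :: "'a \<Rightarrow> 'a \<Rightarrow> 'a" where
  "conjugate g t = g \<otimes> t \<otimes> inv g"

lemma inv_cancel_left:
  assumes "x \<in> carrier G" "y \<in> carrier G"
  shows "inv x \<otimes> (x \<otimes> y) = y" "x \<otimes> (inv x \<otimes> y) = y"
  using assms by (simp_all flip: m_assoc)

lemma conjugate_closed [simp]: "g \<in> carrier G \<Longrightarrow> t \<in> carrier G \<Longrightarrow> conjugate g t \<in> carrier G"
  by (simp add: conjugate_def)

lemma conjugate_one [simp]: "t \<in> carrier G \<Longrightarrow> conjugate \<one> t = t"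
  by (simp add: conjugate_def)

lemma conjugate_conj:
  assumes "g \<in> carrier G" "h \<in> carrier G" "t \<in> carrier G"
  shows "conjugate g (conjugate h t) = conjugate (g \<otimes> h) t"
  using assms by (simp add: conjugate_def m_assoc inv_mult_group)

lemma conjugate_inv_conj [simp]:
  assumes "g \<in> carrier G" "t \<in> carrier G"
  shows "conjugate (inv g) (conjugate g t) = t" "conjugate g (conjugate (inv g) t) = t"
  using assms by (simp_all add: conjugate_conj)

lemma conjugate_mult:
  assumes "g \<in> carrier G" "t \<in> carrier G" "u \<in> carrier G"
  shows "conjugate g (t \<otimes> u) = conjugate g t \<otimes> conjugate g u"
  using assms by (simp add: conjugate_def m_assoc inv_cancel_left)

lemma conjugate_inv_eq_iff:
  assumes "g \<in> carrier G" "t \<in> carrier G" "u \<in> carrier G"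
  shows "conjugate (inv g) t = u \<longleftrightarrow> t = conjugate g u"
  using assms by (metis conjugate_inv_conj)

lemma conjugate_inject [simp]:
  assumes "g \<in> carrier G" "t \<in> carrier G" "u \<in> carrier G"
  shows "conjugate g t = conjugate g u \<longleftrightarrow> t = u"
  using assms by (metis conjugate_inv_conj(1))

lemma conjugate_mult_self:
  assumes "g \<in> carrier G" "t \<in> carrier G"
  shows "conjugate g t \<otimes> g = g \<otimes> t"
  using assms by (simp add: conjugate_def m_assoc)

lemma conjugate_eq_self_iff:
  assumes "g \<in> carrier G" "t \<in> carrier G"
  shows "conjugate g t = t \<longleftrightarrow> g \<otimes> t = t \<otimes> g"
  using assms by (metis conjugate_mult_self conjugate_def inv_solve_right' m_closed)

lemma conjugate_one_right [simp]: "g \<in> carrier G \<Longrightarrow> conjugate g \<one> = \<one>"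
  by (simp add: conjugate_def)

lemma conjugate_commute_iff:
  assumes "g \<in> carrier G" "t \<in> carrier G" "u \<in> carrier G"
  shows "conjugate g t \<otimes> conjugate g u = conjugate g u \<otimes> conjugate g t \<longleftrightarrow> t \<otimes> u = u \<otimes> t"
  using assms by (simp flip: conjugate_mult)

lemma involution_inv:
  assumes "t \<in> carrier G" "t \<otimes> t = \<one>"
  shows "inv t = t"
  using assms by (simp add: inv_equality)

lemma involution_cancel:
  assumes "t \<in> carrier G" "t \<otimes> t = \<one>" "x \<in> carrier G"
  shows "t \<otimes> (t \<otimes> x) = x"
  using assms by (simp flip: m_assoc)

end

text \<open>
  \<^term>\<open>sep t g\<close> stands for ``the wall of the reflection \<open>t\<close> separates \<open>1\<close> from \<open>g\<close>''; it is only
  meaningful for \<open>t\<close> in the group.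
\<close>

locale wall_system = group G for G (structure) +
  fixes S :: "'a set" and sep :: "'a \<Rightarrow> 'a \<Rightarrow> bool"
  assumes S_closed: "s \<in> S \<Longrightarrow> s \<in> carrier G"
    and S_sq: "s \<in> S \<Longrightarrow> s \<otimes> s = \<one>"
    and S_generate: "g \<in> carrier G \<Longrightarrow> \<exists>ws\<in>lists S. g = foldr (\<otimes>) ws \<one>"
    and sep_mult: "\<lbrakk>t \<in> carrier G; g \<in> carrier G; h \<in> carrier G\<rbrakk>
      \<Longrightarrow> sep t (g \<otimes> h) \<longleftrightarrow> sep t g \<noteq> sep (conjugate (inv g) t) h"
    and sep_gen: "\<lbrakk>t \<in> carrier G; s \<in> S\<rbrakk> \<Longrightarrow> sep t s \<longleftrightarrow> t = s"
    and infinite_dihedral: "\<lbrakk>s \<in> S; a \<in> S; s \<otimes> a \<noteq> a \<otimes> s; 0 < n\<rbrakk> \<Longrightarrow> (a \<otimes> s) [^] (n::nat) \<noteq> \<one>"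
begin

declare S_closed [simp, intro] S_sq [simp]

lemma S_inv [simp]: "s \<in> S \<Longrightarrow> inv s = s"
  by (simp add: involution_inv)

lemma S_cancel [simp]: "s \<in> S \<Longrightarrow> x \<in> carrier G \<Longrightarrow> s \<otimes> (s \<otimes> x) = x"
  by (simp add: involution_cancel)

lemma S_cancel_right [simp]: "s \<in> S \<Longrightarrow> x \<in> carrier G \<Longrightarrow> x \<otimes> s \<otimes> s = x"
  by (simp add: m_assoc)

lemma conjugate_gen_gen [simp]: "s \<in> S \<Longrightarrow> conjugate s s = s"
  by (simp add: conjugate_def)

section \<open>Reflections and the sides of their walls\<close>

definition refl :: "'a \<Rightarrow> bool" where
  "refl t \<longleftrightarrow> (\<exists>g\<in>carrier G. \<exists>s\<in>S. t = conjugate g s)"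

lemma reflI: "g \<in> carrier G \<Longrightarrow> s \<in> S \<Longrightarrow> refl (conjugate g s)"
  unfolding refl_def by blast

lemma refl_closed: "refl t \<Longrightarrow> t \<in> carrier G"
  unfolding refl_def by auto

lemma refl_sq: "refl t \<Longrightarrow> t \<otimes> t = \<one>"
  unfolding refl_def by (auto simp flip: conjugate_mult)

lemma refl_inv: "refl t \<Longrightarrow> inv t = t"
  by (simp add: involution_inv refl_closed refl_sq)

lemma refl_conj:
  assumes "refl t" "g \<in> carrier G"
  shows "refl (conjugate g t)"
proof -
  obtain h s where "h \<in> carrier G" "s \<in> S" "t = conjugate h s"
    using assms(1) unfolding refl_def by blast
  then show ?thesis
    using assms(2) by (auto simp: conjugate_conj intro: reflI)
qed

lemma S_refl: "s \<in> S \<Longrightarrow> refl s"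
  using reflI[of \<one> s] by simp

lemma sep_one [simp]: "t \<in> carrier G \<Longrightarrow> \<not> sep t \<one>"
  using sep_mult[of t \<one> \<one>] by simp

lemma sep_inv:
  assumes "t \<in> carrier G" "g \<in> carrier G"
  shows "sep t (inv g) \<longleftrightarrow> sep (conjugate g t) g"
  using sep_mult[of t "inv g" g] assms by simp

lemma sep_mult_gen:
  assumes "t \<in> carrier G" "g \<in> carrier G" "s \<in> S"
  shows "sep t (g \<otimes> s) \<longleftrightarrow> sep t g \<noteq> (t = conjugate g s)"
  using assms by (simp add: sep_mult sep_gen conjugate_inv_eq_iff)

lemma sep_gen_mult:
  assumes "t \<in> carrier G" "g \<in> carrier G" "s \<in> S"
  shows "sep t (s \<otimes> g) \<longleftrightarrow> (t = s) \<noteq> sep (conjugate s t) g"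
  using assms by (simp add: sep_mult sep_gen)

text \<open>On the path from 1 through \<open>g\<close> and \<open>g \<otimes> s\<close> to
  \<open>t\<close>, the last leg is the image of the first under \<open>t\<close>, reversed, so
  together they cross the wall of \<open>t\<close> an even number of times; the middle edge crosses
  it once.\<close>

lemma sep_refl:
  assumes "refl t"
  shows "sep t t"
proof -
  obtain g s where gs: "g \<in> carrier G" "s \<in> S" "t = conjugate g s"
    using assms unfolding refl_def by blast
  have "sep t (g \<otimes> s \<otimes> inv g) \<longleftrightarrow> sep t (g \<otimes> s) \<noteq> sep (conjugate (inv (g \<otimes> s)) t) (inv g)"
    using gs by (intro sep_mult) auto
  also have "conjugate (inv (g \<otimes> s)) t = s"
    using gs by (simp add: conjugate_inv_eq_iff flip: conjugate_conj)
  also have "sep s (inv g) \<longleftrightarrow> sep t g"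
    using gs by (simp add: sep_inv)
  also have "sep t (g \<otimes> s) \<longleftrightarrow> \<not> sep t g"
    using gs by (simp add: sep_mult_gen)
  finally show ?thesis
    using gs by (simp add: conjugate_def)
qed

lemma sep_refl_mult:
  assumes "refl t" "g \<in> carrier G"
  shows "sep t (t \<otimes> g) \<longleftrightarrow> \<not> sep t g"
proof -
  have "conjugate t t = t"
    using assms by (simp add: conjugate_eq_self_iff refl_closed)
  then show ?thesis
    using assms by (simp add: sep_mult sep_refl refl_closed refl_inv)
qed

section \<open>Word length, exchange and descents\<close>

definition prod_word :: "'a list \<Rightarrow> 'a" where
  "prod_word ws = foldr (\<otimes>) ws \<one>"

definition len :: "'a \<Rightarrow> nat" where
  "len g = (LEAST n. \<exists>ws\<in>lists S. g = prod_word ws \<and> n = length ws)"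

lemma prod_word_simps [simp]: "prod_word [] = \<one>" "prod_word (s # ws) = s \<otimes> prod_word ws"
  by (simp_all add: prod_word_def)

lemma prod_word_closed [simp]: "ws \<in> lists S \<Longrightarrow> prod_word ws \<in> carrier G"
  by (induction ws) auto

lemma prod_word_snoc:
  "ws \<in> lists S \<Longrightarrow> s \<in> S \<Longrightarrow> prod_word (ws @ [s]) = prod_word ws \<otimes> s"
  by (induction ws) (auto simp: m_assoc)

lemma len_le: "ws \<in> lists S \<Longrightarrow> len (prod_word ws) \<le> length ws"
  unfolding len_def by (rule Least_le) auto

lemma len_word:
  assumes "g \<in> carrier G"
  obtains ws where "ws \<in> lists S" "g = prod_word ws" "length ws = len g"
proof -
  have "\<exists>n. \<exists>ws\<in>lists S. g = prod_word ws \<and> n = length ws"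
    using S_generate[OF assms] unfolding prod_word_def by blast
  from LeastI_ex[OF this] show ?thesis
    using that unfolding len_def by force
qed

lemma gen_induct_right [consumes 1, case_names one mult]:
  assumes "g \<in> carrier G" "P \<one>" "\<And>g s. g \<in> carrier G \<Longrightarrow> s \<in> S \<Longrightarrow> P g \<Longrightarrow> P (g \<otimes> s)"
  shows "P g"
proof -
  have "P (prod_word ws)" if "ws \<in> lists S" for ws
    using that
  proof (induction ws rule: rev_induct)
    case (snoc s ws)
    then show ?case
      using assms(3)[of "prod_word ws" s] by (simp add: prod_word_snoc)
  qed (simp add: assms)
  then show ?thesis
    using len_word[OF assms(1)] by metis
qed

text \<open>The path spelled by the word crosses the wall of \<open>t\<close>. At the first crossing
  \<open>t\<close> is the conjugate of a letter by the prefix before it, so multiplying by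
  \<open>t\<close> deletes that letter.\<close>

lemma exchange:
  assumes "ws \<in> lists S" "t \<in> carrier G" "sep t (prod_word ws)"
  shows "\<exists>vs\<in>lists S. prod_word vs = t \<otimes> prod_word ws \<and> length vs < length ws"
  using assms
proof (induction ws arbitrary: t)
  case (Cons s ws)
  then have s: "s \<in> S" and ws: "ws \<in> lists S" by auto
  show ?case
  proof (cases "t = s")
    case True
    then show ?thesis
      using s ws by (intro bexI[of _ ws]) auto
  next
    case False
    then have "sep (conjugate s t) (prod_word ws)"
      using Cons.prems s ws by (simp add: sep_gen_mult)
    then obtain vs where vs: "vs \<in> lists S" "prod_word vs = conjugate s t \<otimes> prod_word ws"
        "length vs < length ws"
      using Cons.IH[of "conjugate s t"] Cons.prems s ws by auto
    have "s \<otimes> prod_word vs = t \<otimes> (s \<otimes> prod_word ws)"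
      using s ws Cons.prems by (simp add: vs conjugate_def m_assoc)
    then show ?thesis
      using s vs by (intro bexI[of _ "s # vs"]) auto
  qed
qed simp

lemma len_less:
  assumes "t \<in> carrier G" "g \<in> carrier G" "sep t g"
  shows "len (t \<otimes> g) < len g"
proof -
  obtain ws where ws: "ws \<in> lists S" "g = prod_word ws" "length ws = len g"
    using len_word assms(2) by blast
  then show ?thesis
    using exchange[OF ws(1) assms(1)] assms(3) len_le by (metis order.strict_trans1)
qed

text \<open>The first letter \<open>s\<close> of a shortest word shortens \<open>g\<close>; if its
  wall did not separate 1 from \<open>g\<close>, then \<open>len_less\<close> applied to
  \<open>s \<otimes> g\<close> would give the opposite inequality.\<close>

lemma left_descent:
  assumes "g \<in> carrier G" "g \<noteq> \<one>"
  obtains s where "s \<in> S" "sep s g"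
proof -
  obtain ws where ws: "ws \<in> lists S" "g = prod_word ws" "length ws = len g"
    using len_word assms(1) by blast
  then obtain s vs where sv: "ws = s # vs" "s \<in> S" "vs \<in> lists S"
    using assms(2) by (cases ws) auto
  have "s \<otimes> g = prod_word vs"
    using ws sv by simp
  then have less: "len (s \<otimes> g) < len g"
    using ws sv len_le[of vs] by simp
  have "sep s g"
  proof (rule ccontr)
    assume "\<not> sep s g"
    then have "sep s (s \<otimes> g)"
      using sv assms by (simp add: sep_refl_mult S_refl)
    then show False
      using len_less[of s "s \<otimes> g"] sv assms less by simp
  qed
  with sv show ?thesis
    using that by blast
qed

lemma right_descent:
  assumes "g \<in> carrier G" "g \<noteq> \<one>"
  obtains s where "s \<in> S" "sep (conjugate g s) g"
proof -
  obtain s where "s \<in> S" "sep s (inv g)"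
    using left_descent[of "inv g"] assms by (metis inv_closed inv_inv inv_one)
  then show ?thesis
    using that assms by (simp add: sep_inv)
qed

lemma len_right_less:
  assumes "g \<in> carrier G" "s \<in> S" "sep (conjugate g s) g"
  shows "len (g \<otimes> s) < len g"
  using len_less[of "conjugate g s" g] assms by (simp add: conjugate_mult_self)

text \<open>
  The reflections in the infinite dihedral group generated by non-commuting \<open>s\<close>, \<open>a\<close> form a
  bi-infinite sequence with \<open>t 0 = s\<close> and \<open>t 1 = a\<close>, the identity lying between the walls \<open>0\<close> and
  \<open>1\<close>. The walls \<open>k\<close> to the right of \<open>g\<close> are upwards closed: this persists along a path, since
  crossing the wall \<open>j\<close> amounts to applying the reflection \<open>t j\<close>, which reverses the sequence.
\<close>

lemma descents_commute:
  assumes s: "s \<in> S" and a: "a \<in> S" and g: "g \<in> carrier G" and sep: "sep s g" "sep a g"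
    and ne: "s \<noteq> a"
  shows "s \<otimes> a = a \<otimes> s"
proof (rule ccontr)
  assume nc: "s \<otimes> a \<noteq> a \<otimes> s"
  define p where "p = a \<otimes> s"
  define t where "t k = p [^] (k::int) \<otimes> s" for k
  \<comment> \<open>Wall \<open>k\<close> is to the right of the identity exactly if
    \<open>1 \<le> k\<close>, and its position is reversed if it separates 1 from
    \<open>g\<close>.\<close>
  define right where "right g k \<longleftrightarrow> sep (t k) g \<noteq> (1 \<le> k)" for g k
  define up where "up g \<longleftrightarrow> (\<forall>k l. k \<le> l \<longrightarrow> right g k \<longrightarrow> right g l)" for g
  have p: "p \<in> carrier G" and p_inv: "inv p = s \<otimes> a"
    using s a by (simp_all add: p_def inv_mult_group)
  have t [simp]: "t k \<in> carrier G" for k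
    using s p by (simp add: t_def)
  have pow0: "k = 0" if "p [^] k = \<one>" for k :: int
  proof (rule ccontr)
    assume "k \<noteq> 0"
    have "p [^] int (nat \<bar>k\<bar>) = \<one>"
      using that p int_pow_neg[OF p, of k] by (cases "k \<ge> 0") auto
    then have "p [^] nat \<bar>k\<bar> = \<one>"
      by (simp only: int_pow_int)
    then show False
      using infinite_dihedral[OF s a nc, of "nat \<bar>k\<bar>"] \<open>k \<noteq> 0\<close> by (simp add: p_def)
  qed
  have conj_pow: "conjugate s (p [^] k) = p [^] (- k)" for k :: int
  proof -
    have nat_pow: "conjugate s (p [^] n) = inv p [^] n" for n :: nat
    proof (induction n)
      case (Suc n)
      have "conjugate s p = inv p"
        using s a by (simp add: conjugate_def p_inv) (simp add: p_def m_assoc)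
      then show ?case
        using Suc s p by (simp add: conjugate_mult)
    qed (use s in simp)
    have "conjugate s (p [^] int n) = p [^] (- int n)" for n
      using nat_pow[of n] p by (simp add: int_pow_int int_pow_neg_int nat_pow_inv)
    moreover from this have "conjugate s (p [^] (- int n)) = p [^] int n" for n
      using s p by (metis S_inv S_closed conjugate_inv_conj(1) int_pow_closed)
    ultimately show ?thesis
      by (metis int_cases2 minus_minus)
  qed
  have conj_s: "conjugate s (t k) = t (- k)" for k
    using s p by (simp add: t_def conjugate_mult conj_pow)
  \<comment> \<open>\<open>s\<close> reverses the sequence about position 0 and \<open>a\<close>
    about position 1, hence the index \<open>2 - k\<close>.\<close>
  have conj_a: "conjugate a (t k) = t (2 - k)" for k
  proof -
    have "conjugate a (t k) = conjugate p (conjugate s (t k))"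
      using s a p by (simp add: conjugate_conj p_def m_assoc)
    also have "\<dots> = p \<otimes> p [^] (- k) \<otimes> (s \<otimes> (s \<otimes> a))"
      unfolding conj_s by (simp add: conjugate_def t_def p_inv) (use s a p in \<open>simp add: m_assoc\<close>)
    also have "s \<otimes> (s \<otimes> a) = p \<otimes> s"
      using s a by (simp add: p_def)
    also have "p \<otimes> p [^] (- k) \<otimes> (p \<otimes> s) = t (2 - k)"
      using s p int_pow_mult[OF p, of 1 "- k"] int_pow_mult[OF p, of "1 - k" 1]
      by (simp add: t_def m_assoc)
    finally show ?thesis .
  qed
  have t0: "t k = s \<longleftrightarrow> k = 0" for k
    using pow0[of k] s p by (auto simp: t_def)
  have t1: "t k = a \<longleftrightarrow> k = 1" for k
  proof
    assume "t k = a"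
    then have "p [^] k = p [^] (1::int)"
      using s p by (simp add: t_def) (metis S_cancel_right int_pow_closed p_def)
    then have "p [^] (k - 1) = \<one>"
      using p by (simp add: int_pow_diff)
    then show "k = 1" using pow0[of "k - 1"] by simp
  next
    assume "k = 1"
    then show "t k = a" using s a p by (simp add: t_def) (simp add: p_def)
  qed
  have right_s: "right (s \<otimes> x) k \<longleftrightarrow> \<not> right x (- k)" if "x \<in> carrier G" for x k
    using that s by (auto simp: right_def sep_gen_mult conj_s t0)
  have right_a: "right (a \<otimes> x) k \<longleftrightarrow> \<not> right x (2 - k)" if "x \<in> carrier G" for x k
    using that a by (auto simp: right_def sep_gen_mult conj_a t1)
  have up_s: "up (s \<otimes> x)" if "x \<in> carrier G" "up x" for x
    unfolding up_def
  proof (intro allI impI)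
    fix k l :: int
    assume "k \<le> l" "right (s \<otimes> x) k"
    then show "right (s \<otimes> x) l"
      using that right_s up_def[THEN iffD1, OF that(2), rule_format, of "- l" "- k"] by auto
  qed
  have up_a: "up (a \<otimes> x)" if "x \<in> carrier G" "up x" for x
    unfolding up_def
  proof (intro allI impI)
    fix k l :: int
    assume "k \<le> l" "right (a \<otimes> x) k"
    then show "right (a \<otimes> x) l"
      using that right_a up_def[THEN iffD1, OF that(2), rule_format, of "2 - l" "2 - k"] by auto
  qed
  have up_pow: "up (p [^] k \<otimes> x)" if x: "x \<in> carrier G" "up x" for x and k :: int
  proof (induction k rule: int_induct[where k = 0])
    case base
    then show ?case using x by simp
  next
    case (step1 i)
    have "p [^] (i + 1) \<otimes> x = a \<otimes> (s \<otimes> (p [^] i \<otimes> x))"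
      using s a p x int_pow_mult[OF p, of 1 i] by (simp add: add.commute p_def m_assoc)
    then show ?case
      using up_a up_s step1 s a p x by simp
  next
    case (step2 i)
    have "p [^] (i - 1) \<otimes> x = s \<otimes> (a \<otimes> (p [^] i \<otimes> x))"
      using s a p x int_pow_mult[OF p, of "-1" i] by (simp add: int_pow_neg p_inv m_assoc)
    then show ?case
      using up_a up_s step2 s a p x by simp
  qed
  have "up g"
    using g
  proof (induction rule: gen_induct_right)
    case one
    then show ?case by (auto simp: right_def up_def)
  next
    case (mult g c)
    show ?case
    proof (cases "\<exists>j. t j = conjugate g c")
      case True
      then obtain j where "g \<otimes> c = t j \<otimes> g"
        using mult by (metis conjugate_mult_self S_closed)
      then have "g \<otimes> c = p [^] j \<otimes> (s \<otimes> g)"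
        using s p mult by (simp add: t_def m_assoc)
      then show ?thesis
        using up_pow up_s s mult by simp
    next
      case False
      then have "right (g \<otimes> c) = right g"
        using mult by (auto simp: right_def sep_mult_gen fun_eq_iff)
      then show ?thesis using mult by (simp add: up_def)
    qed
  qed
  \<comment> \<open>\<open>sep s g\<close> puts wall 0 to the right of \<open>g\<close>, while
    \<open>sep a g\<close> puts wall 1 to its left, against upward closure.\<close>
  then have "right g 0 \<longrightarrow> right g 1"
    unfolding up_def by (metis zero_le_one)
  then show False
    using sep t0[of 0] t1[of 1] by (simp add: right_def)
qed

lemma right_descents_commute:
  assumes "s \<in> S" "a \<in> S" "g \<in> carrier G" "sep (conjugate g s) g" "sep (conjugate g a) g" "s \<noteq> a"
  shows "s \<otimes> a = a \<otimes> s"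
  using descents_commute[of s a "inv g"] assms by (simp add: sep_inv)

text \<open>Two edges on the same wall carry the same generator and are joined by a strip of squares.\<close>

lemma wall_induct:
  assumes g: "g \<in> carrier G" "h \<in> carrier G" and s: "s \<in> S" "s' \<in> S"
    and wall: "conjugate g s = conjugate h s'"
    and base: "P g" "P (g \<otimes> s)"
    and step: "\<And>k a. k \<in> carrier G \<Longrightarrow> P k \<Longrightarrow> a \<in> S \<Longrightarrow> a \<noteq> s \<Longrightarrow> a \<otimes> s = s \<otimes> a \<Longrightarrow> P (k \<otimes> a)"
  shows "s' = s \<and> P h"
proof -
  \<comment> \<open>A left descent \<open>a\<close> of \<open>w\<close> is also one of
    \<open>s \<otimes> w = w \<otimes> s'\<close>, and so is \<open>s\<close>; hence the two
    commute, and peeling \<open>a\<close> off \<open>w\<close> moves one square along the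
    wall.\<close>
  have main: "s' = s \<and> (\<forall>k\<in>carrier G. P k \<longrightarrow> P (k \<otimes> w))"
    if "w \<in> carrier G" "\<not> sep s w" "s = conjugate w s'" for w
    using that
  proof (induction "len w" arbitrary: w rule: less_induct)
    case less
    show ?case
    proof (cases "w = \<one>")
      case False
      then obtain a where a: "a \<in> S" "sep a w"
        using left_descent less by blast
      then have "a \<noteq> s" using less by auto
      have "s \<otimes> w = w \<otimes> s'"
        using less s by (metis conjugate_mult_self S_closed)
      then have "sep a (s \<otimes> w)"
        using a s less \<open>a \<noteq> s\<close> by (simp add: sep_mult_gen)
      moreover have "sep s (s \<otimes> w)"
        using s less by (simp add: sep_refl_mult S_refl)
      ultimately have comm: "a \<otimes> s = s \<otimes> a"
        using descents_commute[of a s "s \<otimes> w"] a s less \<open>a \<noteq> s\<close> by auto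
      then have as: "conjugate a s = s"
        using a s by (simp add: conjugate_eq_self_iff)
      have "len (a \<otimes> w) < len w"
        using a less by (intro len_less) auto
      moreover have "\<not> sep s (a \<otimes> w)"
        using less a s as \<open>a \<noteq> s\<close> by (simp add: sep_gen_mult)
      moreover have "s = conjugate (a \<otimes> w) s'"
        using less a s as by (metis conjugate_conj S_closed)
      ultimately have IH: "s' = s \<and> (\<forall>k\<in>carrier G. P k \<longrightarrow> P (k \<otimes> (a \<otimes> w)))"
        using less a by auto
      have "P (k \<otimes> w)" if "k \<in> carrier G" "P k" for k
      proof -
        have "P (k \<otimes> a \<otimes> (a \<otimes> w))"
          using IH step[OF that a(1) \<open>a \<noteq> s\<close> comm] that a by auto
        then show ?thesis
          using that a less by (simp add: m_assoc)
      qed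
      with IH show ?thesis by blast
    qed (use less s in auto)
  qed
  define w where "w = inv g \<otimes> h"
  have w: "w \<in> carrier G" "s = conjugate w s'" "g \<otimes> w = h"
    using g s wall by (simp_all add: w_def inv_cancel_left) (metis S_closed conjugate_conj conjugate_inv_conj(1) inv_closed)
  show ?thesis
  proof (cases "sep s w")
    case False
    then show ?thesis using main[of w] w g base by auto
  next
    \<comment> \<open>Now \<open>w\<close> crosses the wall; starting at the other endpoint
      \<open>g \<otimes> s\<close> replaces it by \<open>s \<otimes> w\<close>. This is why
      \<open>P\<close> is required at both endpoints.\<close>
    case True
    have "conjugate (s \<otimes> w) s' = s"
      using w s by (metis conjugate_conj conjugate_gen_gen S_closed)
    moreover have "g \<otimes> s \<otimes> (s \<otimes> w) = h"
      using g s w by (simp add: m_assoc)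
    moreover have "\<not> sep s (s \<otimes> w)"
      using True w s by (simp add: sep_refl_mult S_refl)
    ultimately show ?thesis
      using main[of "s \<otimes> w"] w g s base by (metis S_closed m_closed)
  qed
qed

section \<open>Transverse walls and walls behind a wall\<close>

text \<open>On the strip of squares joining the two edges some step changes the side of
  \<open>q\<close>; the square at this step has edges on both walls, and \<open>k\<close> is one of
  its vertices.\<close>

lemma transverse_vertex:
  assumes g: "g \<in> carrier G" "h \<in> carrier G" and s: "s \<in> S" "s' \<in> S"
    and wall: "conjugate g s = conjugate h s'"
    and q: "q \<in> carrier G" "q \<noteq> conjugate g s" "sep q g \<noteq> sep q h"
  obtains k b where "k \<in> carrier G" "b \<in> S" "conjugate k s = conjugate g s" "conjugate k b = q" "b \<otimes> s = s \<otimes> b"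
proof -
  \<comment> \<open>\<open>Q\<close> records that a crossing has been found. The invariant for
    \<open>wall_induct\<close> is that either this has happened or the side of \<open>q\<close> is
    still that of \<open>g\<close>.\<close>
  define Q where "Q \<longleftrightarrow>
    (\<exists>k\<in>carrier G. \<exists>b\<in>S. conjugate k s = conjugate g s \<and> conjugate k b = q \<and> b \<otimes> s = s \<otimes> b)"
  have "s' = s \<and> (h \<in> carrier G \<and> conjugate h s = conjugate g s \<and> (sep q h \<longleftrightarrow> sep q g) \<or> Q)"
  proof (rule wall_induct[OF g s wall])
    show "g \<otimes> s \<in> carrier G \<and> conjugate (g \<otimes> s) s = conjugate g s \<and> (sep q (g \<otimes> s) \<longleftrightarrow> sep q g) \<or> Q"
      using g s q by (simp add: sep_mult_gen flip: conjugate_conj)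
  next
    fix k a
    assume k: "k \<in> carrier G" "k \<in> carrier G \<and> conjugate k s = conjugate g s \<and> (sep q k \<longleftrightarrow> sep q g) \<or> Q"
      and a: "a \<in> S" "a \<noteq> s" "a \<otimes> s = s \<otimes> a"
    have "conjugate a s = s"
      using a s by (simp add: conjugate_eq_self_iff)
    then show "k \<otimes> a \<in> carrier G \<and> conjugate (k \<otimes> a) s = conjugate g s \<and> (sep q (k \<otimes> a) \<longleftrightarrow> sep q g) \<or> Q"
      using k a s q unfolding Q_def by (auto simp: sep_mult_gen simp flip: conjugate_conj)
  qed (use g in auto)
  then show ?thesis
    using that q unfolding Q_def by auto
qed

lemma sep_wall_const:
  assumes "g \<in> carrier G" "h \<in> carrier G" "s \<in> S" "s' \<in> S" "conjugate g s = conjugate h s'"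
    and "r \<in> carrier G" "r \<otimes> conjugate g s \<noteq> conjugate g s \<otimes> r"
  shows "sep r g \<longleftrightarrow> sep r h"
proof (rule ccontr)
  assume "sep r g \<noteq> sep r h"
  moreover have "r \<noteq> conjugate g s"
    using assms by auto
  ultimately obtain k b where "k \<in> carrier G" "b \<in> S" "conjugate k s = conjugate g s" "conjugate k b = r"
      "b \<otimes> s = s \<otimes> b"
    using transverse_vertex assms by metis
  then show False
    using assms conjugate_commute_iff[of k b s] by auto
qed

text \<open>The wall of \<open>t\<close> lies in the halfspace of \<open>r\<close> that does not
  contain 1. Both endpoints of an edge are covered, since \<open>g\<close> and
  \<open>g \<otimes> s\<close> conjugate \<open>s\<close> to the same reflection.\<close>

definition beyond :: "'a \<Rightarrow> 'a \<Rightarrow> bool" where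
  "beyond r t \<longleftrightarrow> (\<forall>g\<in>carrier G. \<forall>s\<in>S. conjugate g s = t \<longrightarrow> sep r g)"

lemma beyondI:
  assumes "g \<in> carrier G" "s \<in> S" "sep r g"
    and "r \<in> carrier G" "r \<otimes> conjugate g s \<noteq> conjugate g s \<otimes> r"
  shows "beyond r (conjugate g s)"
  using sep_wall_const assms unfolding beyond_def by metis

text \<open>Distinct commuting reflections have crossing walls, so some vertex \<open>k\<close> lies
  on edges of both. It is behind \<open>r\<close> because the wall of \<open>t\<close> is, and one
  vertex decides for the wall of \<open>t'\<close>.\<close>

lemma beyond_transfer:
  assumes t: "refl t" "refl t'" "t \<noteq> t'" "t \<otimes> t' = t' \<otimes> t"
    and r: "r \<in> carrier G" "r \<otimes> t' \<noteq> t' \<otimes> r" and "beyond r t"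
  shows "beyond r t'"
proof -
  obtain g s where gs: "g \<in> carrier G" "s \<in> S" "t = conjugate g s"
    using t unfolding refl_def by blast
  \<comment> \<open>\<open>t'\<close> preserves the wall of \<open>t\<close> but swaps its own
    sides, so \<open>g\<close> and \<open>t' \<otimes> g\<close> are vertices on the wall of
    \<open>t\<close> that \<open>t'\<close> separates.\<close>
  have "conjugate t' (conjugate g s) = conjugate g s"
    using t gs by (simp add: conjugate_eq_self_iff refl_closed)
  then have "conjugate g s = conjugate (t' \<otimes> g) s"
    using gs t by (simp add: conjugate_conj refl_closed)
  moreover have "sep t' g \<noteq> sep t' (t' \<otimes> g)"
    using gs t by (simp add: sep_refl_mult)
  ultimately obtain k b where kb: "k \<in> carrier G" "b \<in> S" "conjugate k s = conjugate g s" "conjugate k b = t'"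
    using transverse_vertex[of g "t' \<otimes> g" s s t'] gs t by (metis m_closed refl_closed)
  then have "sep r k"
    using assms(7) gs unfolding beyond_def by auto
  then show ?thesis
    using beyondI kb r by blast
qed

definition wall_dist :: "'a \<Rightarrow> nat" where
  "wall_dist t = (LEAST n. \<exists>g\<in>carrier G. \<exists>s\<in>S. conjugate g s = t \<and> n = len g)"

text \<open>A vertex \<open>g\<close> on the wall of \<open>t\<close> closest to 1 is carried to
  \<open>r \<otimes> g\<close>, which is shorter because \<open>r\<close> separates 1 from
  \<open>g\<close>.\<close>

lemma wall_dist_conj_less:
  assumes "refl t" "r \<in> carrier G" "beyond r t"
  shows "wall_dist (conjugate r t) < wall_dist t"
proof -
  have "\<exists>n. \<exists>g\<in>carrier G. \<exists>s\<in>S. conjugate g s = t \<and> n = len g"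
    using assms(1) unfolding refl_def by blast
  from LeastI_ex[OF this] obtain g s
    where gs: "g \<in> carrier G" "s \<in> S" "conjugate g s = t" "wall_dist t = len g"
    unfolding wall_dist_def by blast
  have "conjugate (r \<otimes> g) s = conjugate r t"
    using gs assms by (auto simp: conjugate_conj)
  then have "wall_dist (conjugate r t) \<le> len (r \<otimes> g)"
    unfolding wall_dist_def using gs assms by (intro Least_le) auto
  also have "\<dots> < len g"
    using assms gs len_less unfolding beyond_def by blast
  finally show ?thesis using gs by simp
qed

section \<open>Involutions and centralizers in dimension two\<close>

text \<open>Distinct pairwise commuting generators span cubes, so this forbids cubes of dimension
  three.\<close>

definition two_dimensional :: bool where
  "two_dimensional \<longleftrightarrow> (\<nexists>s a b. s \<in> S \<and> a \<in> S \<and> b \<in> S \<and> s \<noteq> a \<and> s \<noteq> b \<and> a \<noteq> b \<and>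
     s \<otimes> a = a \<otimes> s \<and> s \<otimes> b = b \<otimes> s \<and> a \<otimes> b = b \<otimes> a)"

text \<open>Letters peeled off successively from the left are all descents of \<open>x\<close>
  itself, so they commute pairwise by \<open>descents_commute\<close>; there is no room for a
  third.\<close>

lemma descent_central_cases:
  assumes two: "two_dimensional" and x: "x \<in> carrier G"
    and comm: "\<And>s. s \<in> S \<Longrightarrow> sep s x \<Longrightarrow> s \<otimes> x = x \<otimes> s"
  shows "x = \<one> \<or> x \<in> S \<or> (\<exists>s\<in>S. \<exists>a\<in>S. s \<noteq> a \<and> s \<otimes> a = a \<otimes> s \<and> x = s \<otimes> a)"
proof (rule ccontr)
  assume contra: "\<not> ?thesis"
  \<comment> \<open>As \<open>c\<close> commutes with \<open>y\<close>, the product is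
    \<open>y \<otimes> c\<close>, whose last edge crosses only the wall of \<open>c\<close>; a
    descent other than \<open>c\<close> thus survives the removal of \<open>c\<close>.\<close>
  have peel: "sep b y" if "b \<in> S" "c \<in> S" "y \<in> carrier G" "c \<otimes> y = y \<otimes> c" "b \<noteq> c" "sep b (c \<otimes> y)"
    for b c y
  proof -
    have "conjugate y c = c"
      using that by (simp add: conjugate_eq_self_iff)
    then have "sep b (y \<otimes> c) \<longleftrightarrow> sep b y"
      using that by (simp add: sep_mult_gen)
    then show ?thesis using that by simp
  qed
  obtain s where s: "s \<in> S" "sep s x" "s \<otimes> x = x \<otimes> s"
    using left_descent x contra comm by metis
  define y where "y = s \<otimes> x"
  have y: "y \<in> carrier G" "\<not> sep s y" "x = s \<otimes> y"
    using s(1,2) x by (simp_all add: y_def sep_refl_mult S_refl)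
  then have "y \<noteq> \<one>"
    using s contra by auto
  then obtain a where a: "a \<in> S" "sep a y"
    using left_descent y by blast
  have "a \<noteq> s" using a y by auto
  have ax: "sep a x"
    using peel[of a s x] a s x \<open>a \<noteq> s\<close> unfolding y_def by auto
  then have as: "a \<otimes> s = s \<otimes> a" and ax_comm: "a \<otimes> x = x \<otimes> a"
    using descents_commute[of a s x] a s x \<open>a \<noteq> s\<close> comm by auto
  have ay: "a \<otimes> y = y \<otimes> a"
    using a s x as ax_comm unfolding y_def by (metis S_closed m_assoc)
  define z where "z = a \<otimes> y"
  have "z \<noteq> \<one>"
  proof
    assume "z = \<one>"
    then have "y = a"
      using a y unfolding z_def by (metis S_cancel S_closed r_one)
    then show False
      using contra y a s as \<open>a \<noteq> s\<close> by metis
  qed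
  then obtain b where b: "b \<in> S" "sep b z"
    using left_descent[of z] a y z_def by auto
  have "\<not> sep a z"
    using a y by (simp add: z_def sep_refl_mult S_refl)
  then have "b \<noteq> a" using b by auto
  have "conjugate a s = s"
    using a s as by (simp add: conjugate_eq_self_iff)
  then have "\<not> sep s z"
    using a s y \<open>a \<noteq> s\<close> by (simp add: z_def sep_gen_mult)
  then have "b \<noteq> s" using b by auto
  have "sep b y"
    using peel[of b a y] a b y ay \<open>b \<noteq> a\<close> unfolding z_def by auto
  then have "sep b x"
    using peel[of b s x] b s x \<open>b \<noteq> s\<close> unfolding y_def by auto
  then have "s \<otimes> b = b \<otimes> s" "a \<otimes> b = b \<otimes> a"
    using descents_commute[of s b x] descents_commute[of a b x] a b s x ax \<open>b \<noteq> a\<close> \<open>b \<noteq> s\<close> by auto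
  then show False
    using two as a b s \<open>a \<noteq> s\<close> \<open>b \<noteq> a\<close> \<open>b \<noteq> s\<close> unfolding two_dimensional_def by metis
qed

text \<open>In a shortest conjugate \<open>y\<close> every left descent commutes with
  \<open>y\<close>: since \<open>y\<close> is its own inverse the descent is also a right one, and
  otherwise conjugating by it would shorten \<open>y\<close>.\<close>

lemma involution_cases:
  assumes two: "two_dimensional" and x: "x \<in> carrier G" "x \<noteq> \<one>" "x \<otimes> x = \<one>"
  shows "refl x \<or>
    (\<exists>g\<in>carrier G. \<exists>s\<in>S. \<exists>a\<in>S. s \<noteq> a \<and> s \<otimes> a = a \<otimes> s \<and> x = conjugate g (s \<otimes> a))"
proof -
  define m where "m = (LEAST n. \<exists>g\<in>carrier G. n = len (conjugate g x))"
  have "\<exists>n. \<exists>g\<in>carrier G. n = len (conjugate g x)"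
    by blast
  from LeastI_ex[OF this] obtain g where g: "g \<in> carrier G" "m = len (conjugate g x)"
    unfolding m_def by blast
  have min: "m \<le> len (conjugate h x)" if "h \<in> carrier G" for h
    unfolding m_def using that by (intro Least_le) auto
  define y where "y = conjugate g x"
  have y: "y \<in> carrier G" "y \<otimes> y = \<one>" "y \<noteq> \<one>"
    using g x conjugate_inject[of g x \<one>] by (simp_all add: y_def flip: conjugate_mult)
  then have inv_y: "inv y = y"
    by (simp add: involution_inv)
  have "s \<otimes> y = y \<otimes> s" if s: "s \<in> S" "sep s y" for s
  proof (rule ccontr)
    assume "s \<otimes> y \<noteq> y \<otimes> s"
    then have ne: "conjugate y s \<noteq> s"
      using s y conjugate_eq_self_iff by auto
    then have "sep s (y \<otimes> s)"
      using s y by (auto simp: sep_mult_gen)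
    then have "len (s \<otimes> (y \<otimes> s)) < len (y \<otimes> s)"
      using s y by (intro len_less) auto
    also have "sep (conjugate y s) y"
      using sep_inv[of s y] s y by (simp add: inv_y)
    then have "len (y \<otimes> s) < len y"
      using s y by (intro len_right_less) auto
    also have "s \<otimes> (y \<otimes> s) = conjugate (s \<otimes> g) x"
      using s y g x by (simp add: y_def flip: conjugate_conj) (simp add: conjugate_def m_assoc)
    finally show False
      using min[of "s \<otimes> g"] s g by (simp add: y_def)
  qed
  then have "y \<in> S \<or> (\<exists>s\<in>S. \<exists>a\<in>S. s \<noteq> a \<and> s \<otimes> a = a \<otimes> s \<and> y = s \<otimes> a)"
    using descent_central_cases[OF two y(1)] y by blast
  moreover have "x = conjugate (inv g) y"
    using g x by (simp add: y_def)
  ultimately show ?thesis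
    using g reflI by (metis inv_closed)
qed

text \<open>After multiplication by one of the four candidates, neither \<open>s\<close> nor
  \<open>t\<close> is a left descent. The resulting element permutes \<open>s\<close> and
  \<open>t\<close> by conjugation, and a right descent of it would span a 3-cube with them.\<close>

lemma centralizer_edge:
  assumes two: "two_dimensional" and s: "s \<in> S" and t: "t \<in> S" and ne: "s \<noteq> t"
    and st: "s \<otimes> t = t \<otimes> s"
    and x: "x \<in> carrier G" "x \<otimes> (s \<otimes> t) = s \<otimes> t \<otimes> x"
  shows "x \<in> {\<one>, s, t, s \<otimes> t}"
proof -
  have conj_st [simp]: "conjugate s t = t" "conjugate t s = s"
    using s t st by (simp_all add: conjugate_eq_self_iff)
  have base: "y = \<one>" if y: "y \<in> carrier G" "y \<otimes> (s \<otimes> t) = s \<otimes> t \<otimes> y" "\<not> sep s y" "\<not> sep t y" for y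
  proof (rule ccontr)
    assume "y \<noteq> \<one>"
    then obtain a where a: "a \<in> S" "sep (conjugate y a) y"
      using right_descent y by blast
    \<comment> \<open>The wall of \<open>u\<close> separates 1 from
      \<open>s \<otimes> t \<otimes> y = y \<otimes> s \<otimes> t\<close> but not from
      \<open>y\<close>, so one of the last two edges crosses it.\<close>
    have key: "\<exists>c\<in>{s, t}. conjugate y c = u" if u: "u \<in> {s, t}" for u
    proof -
      have "sep u (s \<otimes> t \<otimes> y)"
        using u s t ne y by (auto simp: sep_gen_mult m_assoc)
      then have "sep u (y \<otimes> s \<otimes> t)"
        using y s t by (simp add: m_assoc)
      then have "u = conjugate y s \<or> u = conjugate (y \<otimes> s) t"
        using u y s t by (auto simp: sep_mult_gen)
      then show ?thesis
        using y s t by (auto simp flip: conjugate_conj)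
    qed
    \<comment> \<open>Both \<open>a\<close> and \<open>c\<close> are right descents of
      \<open>y \<otimes> c = u \<otimes> y\<close>.\<close>
    have comm: "a \<noteq> c \<and> a \<otimes> c = c \<otimes> a" if c: "c \<in> {s, t}" and u: "u \<in> {s, t}" "conjugate y c = u" for c u
    proof -
      have cS: "c \<in> S" "u \<in> S" "\<not> sep u y" using c u s t y by auto
      have ac: "a \<noteq> c" using a u cS by auto
      have yc: "y \<otimes> c = u \<otimes> y"
        using u cS y by (metis S_closed conjugate_mult_self)
      have "conjugate (y \<otimes> c) c = u"
        using u cS y by (simp flip: conjugate_conj)
      moreover have "sep u (y \<otimes> c)"
        using cS y by (simp add: yc sep_refl_mult S_refl)
      moreover have "sep (conjugate (y \<otimes> c) a) (y \<otimes> c)"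
      proof -
        have "conjugate (y \<otimes> c) a = conjugate u (conjugate y a)"
          using yc a cS y by (metis conjugate_conj S_closed)
        moreover have "conjugate u (conjugate y a) \<noteq> u"
          using a cS y ac u conjugate_inject[of u "conjugate y a" u] conjugate_inject[of y a c] by auto
        ultimately show ?thesis
          using a cS y by (simp add: yc sep_gen_mult conjugate_conj)
      qed
      ultimately show ?thesis
        using right_descents_commute[of a c "y \<otimes> c"] a cS y ac by auto
    qed
    obtain c c' where "c \<in> {s, t}" "conjugate y c = s" "c' \<in> {s, t}" "conjugate y c' = t"
      using key by (metis insertCI)
    then have "a \<noteq> s \<and> a \<otimes> s = s \<otimes> a" "a \<noteq> t \<and> a \<otimes> t = t \<otimes> a"
      using comm ne by (metis insertE insertI1 insertI2 singletonD)+
    then show False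
      using two a s t ne st unfolding two_dimensional_def by metis
  qed
  obtain m where m: "m \<in> {\<one>, s, t, s \<otimes> t}" "\<not> sep s (m \<otimes> x)" "\<not> sep t (m \<otimes> x)"
  proof -
    have "sep s (s \<otimes> x) = (\<not> sep s x)" "sep t (s \<otimes> x) = sep t x"
      "sep s (t \<otimes> x) = sep s x" "sep t (t \<otimes> x) = (\<not> sep t x)"
      "sep s (s \<otimes> t \<otimes> x) = (\<not> sep s x)" "sep t (s \<otimes> t \<otimes> x) = (\<not> sep t x)"
      using s t x ne by (simp_all add: sep_gen_mult m_assoc)
    then show ?thesis
      using that x by (metis insertCI l_one)
  qed
  have "m \<in> carrier G" "m \<otimes> m = \<one>" "m \<otimes> (s \<otimes> t) = s \<otimes> t \<otimes> m"
    using m s t st by (auto simp: m_assoc) (metis S_cancel S_closed S_sq m_assoc)+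
  moreover from this have "m \<otimes> x \<otimes> (s \<otimes> t) = s \<otimes> t \<otimes> (m \<otimes> x)"
    using x s t by (metis S_closed m_assoc m_closed)
  ultimately have "m \<otimes> x = \<one>"
    using base[of "m \<otimes> x"] m x by auto
  then have "x = m"
    using \<open>m \<in> carrier G\<close> \<open>m \<otimes> m = \<one>\<close> x by (metis inv_equality inv_inv involution_inv)
  then show ?thesis using m by simp
qed

end

section \<open>Right-angled Coxeter groups\<close>

lemma words_Cons [simp]: "l # w \<in> words X \<longleftrightarrow> fst l \<in> X \<and> w \<in> words X"
  by (cases l) (auto simp: words_def)

context
  fixes \<Gamma> :: "'a graph"
begin

lemma racg_carrier: "carrier (racg \<Gamma>) = (\<lambda>w. word_rel (verts \<Gamma>) (racg_relators \<Gamma>) `` {w}) ` words (verts \<Gamma>)"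
  by (auto simp: racg_def presented_group_def quotient_def)

lemma gen_closed [simp]: "u \<in> verts \<Gamma> \<Longrightarrow> gen \<Gamma> u \<in> carrier (racg \<Gamma>)"
  unfolding racg_carrier gen_def by (auto simp: words_def)

lemma racg_one: "\<one>\<^bsub>racg \<Gamma>\<^esub> = word_rel (verts \<Gamma>) (racg_relators \<Gamma>) `` {[]}"
  by (simp add: racg_def presented_group_def)

lemma racg_class_eq:
  assumes "word_step (verts \<Gamma>) (racg_relators \<Gamma>) v w" "v \<in> words (verts \<Gamma>)" "w \<in> words (verts \<Gamma>)"
  shows "word_rel (verts \<Gamma>) (racg_relators \<Gamma>) `` {v} = word_rel (verts \<Gamma>) (racg_relators \<Gamma>) `` {w}"
  using assms by (intro equiv_class_eq[OF equiv_word_rel]) (auto simp: word_rel_def)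

lemma racg_class_append:
  assumes "v \<in> words (verts \<Gamma>)" "w \<in> words (verts \<Gamma>)"
  shows "word_rel (verts \<Gamma>) (racg_relators \<Gamma>) `` {v} \<otimes>\<^bsub>racg \<Gamma>\<^esub> word_rel (verts \<Gamma>) (racg_relators \<Gamma>) `` {w}
    = word_rel (verts \<Gamma>) (racg_relators \<Gamma>) `` {v @ w}"
  unfolding racg_def by (rule presented_group_mult[OF assms])

lemma gen_sq [simp]:
  assumes "u \<in> verts \<Gamma>"
  shows "gen \<Gamma> u \<otimes>\<^bsub>racg \<Gamma>\<^esub> gen \<Gamma> u = \<one>\<^bsub>racg \<Gamma>\<^esub>"
proof -
  have "word_step (verts \<Gamma>) (racg_relators \<Gamma>) ([] @ [(u, True), (u, True)] @ []) ([] @ [])"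
    by (rule word_step.relator) (use assms in \<open>auto simp: racg_relators_def\<close>)
  then show ?thesis
    using racg_class_eq[of "[(u, True), (u, True)]" "[]"] racg_class_append[of "[(u, True)]" "[(u, True)]"] assms
    by (simp add: gen_def racg_one words_def)
qed

text \<open>Deleting either the square or the cancelling pair from the word
  \<open>(u, True)\<close>, \<open>(u, True)\<close>, \<open>(u, False)\<close> leaves one letter,
  of either sign.\<close>

lemma gen_inverse_letter:
  assumes "u \<in> verts \<Gamma>"
  shows "word_rel (verts \<Gamma>) (racg_relators \<Gamma>) `` {[(u, b)]} = gen \<Gamma> u"
proof (cases b)
  case False
  have "word_step (verts \<Gamma>) (racg_relators \<Gamma>)
      ([] @ [(u, True), (u, True)] @ [(u, False)]) ([] @ [(u, False)])"
    by (rule word_step.relator) (use assms in \<open>auto simp: racg_relators_def words_def\<close>)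
  moreover have "word_step (verts \<Gamma>) (racg_relators \<Gamma>)
      ([(u, True)] @ [(u, True), (u, \<not> True)] @ []) ([(u, True)] @ [])"
    by (rule word_step.cancel) (use assms in \<open>auto simp: words_def\<close>)
  ultimately show ?thesis
    using racg_class_eq[of "[(u, True), (u, True), (u, False)]" "[(u, False)]"]
      racg_class_eq[of "[(u, True), (u, True), (u, False)]" "[(u, True)]"] assms False
    by (simp add: gen_def words_def)
qed (simp add: gen_def)

lemma racg_generate:
  assumes "g \<in> carrier (racg \<Gamma>)"
  shows "\<exists>ws\<in>lists (gen \<Gamma> ` verts \<Gamma>). g = foldr (\<otimes>\<^bsub>racg \<Gamma>\<^esub>) ws \<one>\<^bsub>racg \<Gamma>\<^esub>"
proof -
  have "word_rel (verts \<Gamma>) (racg_relators \<Gamma>) `` {w} =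
      foldr (\<otimes>\<^bsub>racg \<Gamma>\<^esub>) (map (\<lambda>l. gen \<Gamma> (fst l)) w) \<one>\<^bsub>racg \<Gamma>\<^esub>"
    if "w \<in> words (verts \<Gamma>)" for w
    using that
  proof (induction w)
    case (Cons l w)
    then have l: "fst l \<in> verts \<Gamma>" and w: "w \<in> words (verts \<Gamma>)"
      by (auto simp: words_def)
    then have "word_rel (verts \<Gamma>) (racg_relators \<Gamma>) `` {[l] @ w} =
        gen \<Gamma> (fst l) \<otimes>\<^bsub>racg \<Gamma>\<^esub> word_rel (verts \<Gamma>) (racg_relators \<Gamma>) `` {w}"
      using racg_class_append[of "[l]" w] gen_inverse_letter[of "fst l" "snd l"]
      by (cases l) (auto simp: words_def)
    then show ?case
      using Cons.IH w by simp
  qed (simp add: racg_one)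
  moreover have "map (\<lambda>l. gen \<Gamma> (fst l)) w \<in> lists (gen \<Gamma> ` verts \<Gamma>)" if "w \<in> words (verts \<Gamma>)" for w
    using that by (auto simp: words_def lists_eq_set)
  ultimately show ?thesis
    using assms unfolding racg_carrier by blast
qed

text \<open>Universal property: deleting a relator or a cancelling pair does not change the value of
  a word in \<open>H\<close>, so evaluation descends to classes.\<close>

lemma racg_hom_exists:
  fixes H (structure)
  assumes "group H"
    and f_closed: "\<And>u. u \<in> verts \<Gamma> \<Longrightarrow> f u \<in> carrier H"
    and f_sq: "\<And>u. u \<in> verts \<Gamma> \<Longrightarrow> f u \<otimes> f u = \<one>"
    and f_comm: "\<And>u v. u \<in> verts \<Gamma> \<Longrightarrow> v \<in> verts \<Gamma> \<Longrightarrow> {u, v} \<in> edges \<Gamma> \<Longrightarrow> f u \<otimes> f v = f v \<otimes> f u"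
  shows "\<exists>h\<in>hom (racg \<Gamma>) H. \<forall>u\<in>verts \<Gamma>. h (gen \<Gamma> u) = f u"
proof -
  interpret H: group H by fact
  \<comment> \<open>The sign of a letter is ignored, because \<open>f u\<close> is its own
    inverse.\<close>
  define ev where "ev w = foldr (\<lambda>l x. f (fst l) \<otimes> x) w \<one>" for w :: "'a word"
  have ev_simps [simp]: "ev [] = \<one>" "ev (l # w) = f (fst l) \<otimes> ev w" for l w
    by (simp_all add: ev_def)
  have ev_closed [simp]: "ev w \<in> carrier H" if "w \<in> words (verts \<Gamma>)" for w
    using that by (induction w) (auto simp: f_closed)
  have ev_append: "ev (v @ w) = ev v \<otimes> ev w" if "v \<in> words (verts \<Gamma>)" "w \<in> words (verts \<Gamma>)" for v w
    using that by (induction v) (auto simp: H.m_assoc f_closed)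
  have ev_context: "ev (a @ r @ b) = ev (a @ b)"
    if "a \<in> words (verts \<Gamma>)" "b \<in> words (verts \<Gamma>)" "r \<in> words (verts \<Gamma>)" "ev r = \<one>" for a r b
    using that by (simp add: ev_append)
  have ev_step: "ev v = ev w" if "word_step (verts \<Gamma>) (racg_relators \<Gamma>) v w" for v w
    using that
  proof cases
    case (cancel a b x s)
    then show ?thesis
      using ev_context[of a b "[(x, s), (x, \<not> s)]"] f_sq f_closed by (auto simp: words_def)
  next
    case (relator a b r)
    have "r \<in> words (verts \<Gamma>) \<and> ev r = \<one>"
      using \<open>r \<in> racg_relators \<Gamma>\<close> unfolding racg_relators_def
    proof (elim UnE CollectE exE conjE)
      fix u v assume r: "r = [(u, True), (v, True), (u, False), (v, False)]"
        and uv: "u \<in> verts \<Gamma>" "v \<in> verts \<Gamma>" "{u, v} \<in> edges \<Gamma>"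
      have "ev r = f u \<otimes> (f v \<otimes> f u) \<otimes> f v"
        using r uv f_closed by (simp add: H.m_assoc)
      also have "f v \<otimes> f u = f u \<otimes> f v"
        using f_comm[OF uv] by simp
      also have "f u \<otimes> (f u \<otimes> f v) \<otimes> f v = f u \<otimes> f u \<otimes> (f v \<otimes> f v)"
        using uv f_closed by (simp add: H.m_assoc)
      finally show ?thesis
        using r uv f_sq by (simp add: words_def)
    qed (auto simp: words_def f_sq f_closed)
    then show ?thesis
      using relator ev_context by simp
  qed
  have ev_rel: "ev v = ev w" if "(v, w) \<in> word_rel (verts \<Gamma>) (racg_relators \<Gamma>)" for v w
  proof -
    have "equivclp (word_step (verts \<Gamma>) (racg_relators \<Gamma>)) v w"
      using that by (simp add: word_rel_def)
    then show ?thesis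
      by (induction rule: equivclp_induct) (auto dest: ev_step)
  qed
  define h where "h A = ev (SOME w. w \<in> A)" for A
  have h_class: "h (word_rel (verts \<Gamma>) (racg_relators \<Gamma>) `` {w}) = ev w" if w: "w \<in> words (verts \<Gamma>)" for w
  proof -
    have "w \<in> word_rel (verts \<Gamma>) (racg_relators \<Gamma>) `` {w}"
      using w by (simp add: word_rel_def)
    then have "(SOME v. v \<in> word_rel (verts \<Gamma>) (racg_relators \<Gamma>) `` {w})
        \<in> word_rel (verts \<Gamma>) (racg_relators \<Gamma>) `` {w}"
      by (rule someI)
    then show ?thesis
      using ev_rel unfolding h_def by auto
  qed
  have "h \<in> hom (racg \<Gamma>) H"
    unfolding hom_def by (auto simp: racg_carrier h_class racg_class_append ev_append)
  moreover have "h (gen \<Gamma> u) = f u" if "u \<in> verts \<Gamma>" for u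
    using that h_class[of "[(u, True)]"] f_closed by (simp add: gen_def words_def)
  ultimately show ?thesis
    by blast
qed

lemma racg_hom_eq:
  fixes H (structure)
  assumes "group H" and h: "h \<in> hom (racg \<Gamma>) H" "k \<in> hom (racg \<Gamma>) H"
    and eq: "\<And>u. u \<in> verts \<Gamma> \<Longrightarrow> h (gen \<Gamma> u) = k (gen \<Gamma> u)"
    and g: "g \<in> carrier (racg \<Gamma>)"
  shows "h g = k g"
proof -
  interpret W: group "racg \<Gamma>" by (rule group_racg)
  have "foldr (\<otimes>\<^bsub>racg \<Gamma>\<^esub>) ws \<one>\<^bsub>racg \<Gamma>\<^esub> \<in> carrier (racg \<Gamma>) \<and>
      h (foldr (\<otimes>\<^bsub>racg \<Gamma>\<^esub>) ws \<one>\<^bsub>racg \<Gamma>\<^esub>) = k (foldr (\<otimes>\<^bsub>racg \<Gamma>\<^esub>) ws \<one>\<^bsub>racg \<Gamma>\<^esub>)"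
    if "ws \<in> lists (gen \<Gamma> ` verts \<Gamma>)" for ws
    using that
  proof (induction ws)
    case Nil
    then show ?case
      using hom_one[OF h(1) group_racg \<open>group H\<close>] hom_one[OF h(2) group_racg \<open>group H\<close>] by simp
  next
    case (Cons s ws)
    then show ?case
      using eq h by (auto simp: hom_mult)
  qed
  then show ?thesis
    using racg_generate[OF g] by blast
qed

text \<open>Since formal inverses equal the generators, the commutator relator says that
  \<open>uv\<close> has trivial square, hence equals its inverse \<open>vu\<close>.\<close>

lemma gen_commute:
  assumes "u \<in> verts \<Gamma>" "v \<in> verts \<Gamma>" "{u, v} \<in> edges \<Gamma>"
  shows "gen \<Gamma> u \<otimes>\<^bsub>racg \<Gamma>\<^esub> gen \<Gamma> v = gen \<Gamma> v \<otimes>\<^bsub>racg \<Gamma>\<^esub> gen \<Gamma> u"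
proof -
  interpret W: group "racg \<Gamma>" by (rule group_racg)
  let ?w = "[(u, True), (v, True), (u, False), (v, False)]"
  let ?c = "\<lambda>w. word_rel (verts \<Gamma>) (racg_relators \<Gamma>) `` {w}"
  have "word_step (verts \<Gamma>) (racg_relators \<Gamma>) ([] @ ?w @ []) ([] @ [])"
    by (rule word_step.relator) (use assms in \<open>auto simp: racg_relators_def\<close>)
  then have "?c ?w = \<one>\<^bsub>racg \<Gamma>\<^esub>"
    using racg_class_eq[of ?w "[]"] assms by (simp add: racg_one words_def)
  moreover have "?c ?w = ?c [(u, True)] \<otimes>\<^bsub>racg \<Gamma>\<^esub> (?c [(v, True)] \<otimes>\<^bsub>racg \<Gamma>\<^esub>
      (?c [(u, False)] \<otimes>\<^bsub>racg \<Gamma>\<^esub> ?c [(v, False)]))"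
    using assms by (simp add: racg_class_append words_def)
  ultimately have "gen \<Gamma> u \<otimes>\<^bsub>racg \<Gamma>\<^esub> gen \<Gamma> v \<otimes>\<^bsub>racg \<Gamma>\<^esub> (gen \<Gamma> u \<otimes>\<^bsub>racg \<Gamma>\<^esub> gen \<Gamma> v) = \<one>\<^bsub>racg \<Gamma>\<^esub>"
    using assms by (simp add: gen_inverse_letter W.m_assoc)
  then have "inv\<^bsub>racg \<Gamma>\<^esub> (gen \<Gamma> u \<otimes>\<^bsub>racg \<Gamma>\<^esub> gen \<Gamma> v) = gen \<Gamma> u \<otimes>\<^bsub>racg \<Gamma>\<^esub> gen \<Gamma> v"
    using assms by (simp add: W.inv_equality)
  then show ?thesis
    using assms by (simp add: W.inv_mult_group W.involution_inv)
qed

end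

text \<open>
  The semidirect product of the sets of group elements (under symmetric difference) with the group,
  acting by conjugation. The homomorphism \<open>u \<mapsto> ({u}, u)\<close> of a right-angled Coxeter group records in
  its first component the set of reflections whose walls separate \<open>1\<close> from a given element.
\<close>

definition wall_group :: "('a, 'b) monoid_scheme \<Rightarrow> ('a set \<times> 'a) monoid" where
  "wall_group G =
     \<lparr>carrier = Pow (carrier G) \<times> carrier G,
      mult = (\<lambda>(A, g) (B, h).
        ({t \<in> carrier G. (t \<in> A) \<noteq> (group.conjugate G (inv\<^bsub>G\<^esub> g) t \<in> B)}, g \<otimes>\<^bsub>G\<^esub> h)),
      one = ({}, \<one>\<^bsub>G\<^esub>)\<rparr>"

lemma (in group) group_wall_group: "group (wall_group G)"
proof (rule groupI)
  fix x y z
  assume "x \<in> carrier (wall_group G)" "y \<in> carrier (wall_group G)" "z \<in> carrier (wall_group G)"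
  then show "x \<otimes>\<^bsub>wall_group G\<^esub> y \<otimes>\<^bsub>wall_group G\<^esub> z = x \<otimes>\<^bsub>wall_group G\<^esub> (y \<otimes>\<^bsub>wall_group G\<^esub> z)"
    by (auto simp: wall_group_def m_assoc conjugate_conj inv_mult_group)
next
  fix x assume x: "x \<in> carrier (wall_group G)"
  then show "\<one>\<^bsub>wall_group G\<^esub> \<otimes>\<^bsub>wall_group G\<^esub> x = x"
    by (auto simp: wall_group_def)
  obtain A g where "x = (A, g)" by (cases x)
  with x have "({t \<in> carrier G. conjugate g t \<in> A}, inv g) \<in> carrier (wall_group G)"
    "({t \<in> carrier G. conjugate g t \<in> A}, inv g) \<otimes>\<^bsub>wall_group G\<^esub> x = \<one>\<^bsub>wall_group G\<^esub>"
    by (auto simp: wall_group_def)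
  then show "\<exists>y\<in>carrier (wall_group G). y \<otimes>\<^bsub>wall_group G\<^esub> x = \<one>\<^bsub>wall_group G\<^esub>"
    by blast
qed (auto simp: wall_group_def)

text \<open>\<open>(a, p)\<close> is the isometry x \<mapsto> a - x of the integers if
  \<open>p\<close> holds and x \<mapsto> a + x otherwise; the product is composition.\<close>

definition infinite_dihedral_group :: "(int \<times> bool) monoid" where
  "infinite_dihedral_group =
     \<lparr>carrier = UNIV,
      mult = (\<lambda>(a, p) (b, q). (if p then a - b else a + b, p \<noteq> q)),
      one = (0, False)\<rparr>"

lemma group_infinite_dihedral_group: "group infinite_dihedral_group"
proof (rule groupI)
  fix x :: "int \<times> bool"
  obtain a p where "x = (a, p)" by (cases x)
  then show "\<exists>y\<in>carrier infinite_dihedral_group.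
      y \<otimes>\<^bsub>infinite_dihedral_group\<^esub> x = \<one>\<^bsub>infinite_dihedral_group\<^esub>"
    by (intro bexI[of _ "(if p then a else - a, p)"]) (simp_all add: infinite_dihedral_group_def)
qed (auto simp: infinite_dihedral_group_def)

text \<open>Non-adjacent generators are detected by killing all others.\<close>

lemma gen_mult_infinite_order:
  assumes uv: "u \<in> verts \<Gamma>" "v \<in> verts \<Gamma>" "u \<noteq> v" "{u, v} \<notin> edges \<Gamma>" and "0 < n"
  shows "(gen \<Gamma> u \<otimes>\<^bsub>racg \<Gamma>\<^esub> gen \<Gamma> v) [^]\<^bsub>racg \<Gamma>\<^esub> (n::nat) \<noteq> \<one>\<^bsub>racg \<Gamma>\<^esub>"
proof
  interpret W: group "racg \<Gamma>" by (rule group_racg)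
  interpret D: group infinite_dihedral_group by (rule group_infinite_dihedral_group)
  \<comment> \<open>The reflections x \<mapsto> 1 - x and x \<mapsto> -x, whose product is the
    translation by 1.\<close>
  define f :: "'a \<Rightarrow> int \<times> bool"
    where "f x = (if x = u then (1, True) else if x = v then (0, True) else (0, False))" for x
  have "{v, u} \<notin> edges \<Gamma>"
    using uv by (simp add: insert_commute)
  with uv have "\<exists>h\<in>hom (racg \<Gamma>) infinite_dihedral_group. \<forall>x\<in>verts \<Gamma>. h (gen \<Gamma> x) = f x"
    by (intro racg_hom_exists[OF group_infinite_dihedral_group])
      (auto simp: f_def infinite_dihedral_group_def)
  then obtain h where h: "h \<in> hom (racg \<Gamma>) infinite_dihedral_group"
      "\<And>x. x \<in> verts \<Gamma> \<Longrightarrow> h (gen \<Gamma> x) = f x"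
    by blast
  have "h (gen \<Gamma> u \<otimes>\<^bsub>racg \<Gamma>\<^esub> gen \<Gamma> v) = (1, False)"
    using uv h by (simp add: hom_mult f_def) (simp add: infinite_dihedral_group_def)
  moreover have "(1, False) [^]\<^bsub>infinite_dihedral_group\<^esub> k = (int k, False)" for k :: nat
    by (induction k) (simp_all add: infinite_dihedral_group_def nat_pow_def)
  ultimately have "h ((gen \<Gamma> u \<otimes>\<^bsub>racg \<Gamma>\<^esub> gen \<Gamma> v) [^]\<^bsub>racg \<Gamma>\<^esub> n) = (int n, False)"
    using uv h W.is_group D.is_group by (simp add: hom_nat_pow)
  moreover assume "(gen \<Gamma> u \<otimes>\<^bsub>racg \<Gamma>\<^esub> gen \<Gamma> v) [^]\<^bsub>racg \<Gamma>\<^esub> n = \<one>\<^bsub>racg \<Gamma>\<^esub>"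
  ultimately show False
    using hom_one[OF h(1)] W.is_group D.is_group \<open>0 < n\<close> by (simp add: infinite_dihedral_group_def)
qed

lemma hom_conj:
  assumes "group G" "group H" "h \<in> hom G H" "g \<in> carrier G" "t \<in> carrier G"
  shows "h (group.conjugate G g t) = group.conjugate H (h g) (h t)"
proof -
  interpret group_hom G H h
    using assms by (simp add: group_hom_def group_hom_axioms_def)
  show ?thesis
    using assms by (simp add: G.conjugate_def H.conjugate_def)
qed

lemma racg_wall_system:
  fixes \<Gamma> :: "'a graph"
  obtains sep where "wall_system (racg \<Gamma>) (gen \<Gamma> ` verts \<Gamma>) sep"
proof -
  interpret W: group "racg \<Gamma>" by (rule group_racg)
  have conj_eq: "W.conjugate (gen \<Gamma> u) (gen \<Gamma> v) = gen \<Gamma> v"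
    if "u \<in> verts \<Gamma>" "v \<in> verts \<Gamma>" "u = v \<or> {u, v} \<in> edges \<Gamma>" for u v
    using that by (metis W.conjugate_eq_self_iff gen_closed gen_commute)
  have "\<exists>F\<in>hom (racg \<Gamma>) (wall_group (racg \<Gamma>)). \<forall>u\<in>verts \<Gamma>. F (gen \<Gamma> u) = ({gen \<Gamma> u}, gen \<Gamma> u)"
  proof (rule racg_hom_exists[OF W.group_wall_group])
    \<comment> \<open>Conjugation by one generator fixes the other, so the first component is the
      symmetric difference of two singletons: empty for equal vertices, symmetric in
      \<open>u\<close> and \<open>v\<close> for adjacent ones. This settles both kinds of
      relators.\<close>
    have mult: "({gen \<Gamma> u}, gen \<Gamma> u) \<otimes>\<^bsub>wall_group (racg \<Gamma>)\<^esub> ({gen \<Gamma> v}, gen \<Gamma> v) =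
        ({t \<in> carrier (racg \<Gamma>). (t = gen \<Gamma> u) \<noteq> (t = gen \<Gamma> v)}, gen \<Gamma> u \<otimes>\<^bsub>racg \<Gamma>\<^esub> gen \<Gamma> v)"
      if "u \<in> verts \<Gamma>" "v \<in> verts \<Gamma>" "u = v \<or> {u, v} \<in> edges \<Gamma>" for u v
      using that conj_eq[OF that] by (simp add: wall_group_def W.conjugate_inv_eq_iff cong: conj_cong)
    fix u v
    assume u: "u \<in> verts \<Gamma>"
    then show "({gen \<Gamma> u}, gen \<Gamma> u) \<in> carrier (wall_group (racg \<Gamma>))"
      by (simp add: wall_group_def)
    show "({gen \<Gamma> u}, gen \<Gamma> u) \<otimes>\<^bsub>wall_group (racg \<Gamma>)\<^esub> ({gen \<Gamma> u}, gen \<Gamma> u) = \<one>\<^bsub>wall_group (racg \<Gamma>)\<^esub>"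
      using u by (simp add: mult) (simp add: wall_group_def)
    assume v: "v \<in> verts \<Gamma>" "{u, v} \<in> edges \<Gamma>"
    then have vu: "{v, u} \<in> edges \<Gamma>"
      by (simp add: insert_commute)
    have swap: "{t \<in> carrier (racg \<Gamma>). (t = gen \<Gamma> u) \<noteq> (t = gen \<Gamma> v)} =
        {t \<in> carrier (racg \<Gamma>). (t = gen \<Gamma> v) \<noteq> (t = gen \<Gamma> u)}"
      by blast
    show "({gen \<Gamma> u}, gen \<Gamma> u) \<otimes>\<^bsub>wall_group (racg \<Gamma>)\<^esub> ({gen \<Gamma> v}, gen \<Gamma> v) =
        ({gen \<Gamma> v}, gen \<Gamma> v) \<otimes>\<^bsub>wall_group (racg \<Gamma>)\<^esub> ({gen \<Gamma> u}, gen \<Gamma> u)"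
      unfolding mult[OF u v(1) disjI2[OF v(2)]] mult[OF v(1) u disjI2[OF vu]] swap gen_commute[OF u v] ..
  qed
  then obtain F where F: "F \<in> hom (racg \<Gamma>) (wall_group (racg \<Gamma>))"
      "\<And>u. u \<in> verts \<Gamma> \<Longrightarrow> F (gen \<Gamma> u) = ({gen \<Gamma> u}, gen \<Gamma> u)"
    by blast
  \<comment> \<open>The product of \<open>wall_group\<close> conjugates by the second component,
    which must be \<open>g\<close> itself for the first component to obey
    \<open>sep_mult\<close>.\<close>
  have snd_F: "snd (F g) = g" if "g \<in> carrier (racg \<Gamma>)" for g
  proof -
    have hom: "(\<lambda>g. snd (F g)) \<in> hom (racg \<Gamma>) (racg \<Gamma>)"
    proof (rule homI)
      fix x y assume xy: "x \<in> carrier (racg \<Gamma>)" "y \<in> carrier (racg \<Gamma>)"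
      then have "F x \<in> carrier (wall_group (racg \<Gamma>))"
        using F by (meson hom_in_carrier)
      then show "snd (F x) \<in> carrier (racg \<Gamma>)"
        by (auto simp: wall_group_def)
      show "snd (F (x \<otimes>\<^bsub>racg \<Gamma>\<^esub> y)) = snd (F x) \<otimes>\<^bsub>racg \<Gamma>\<^esub> snd (F y)"
        using xy F by (simp add: hom_mult) (simp add: wall_group_def split_beta)
    qed
    have id: "(\<lambda>g. g) \<in> hom (racg \<Gamma>) (racg \<Gamma>)"
      by (auto simp: hom_def)
    show ?thesis
      by (rule racg_hom_eq[OF group_racg hom id _ that]) (simp add: F(2))
  qed
  have "wall_system (racg \<Gamma>) (gen \<Gamma> ` verts \<Gamma>) (\<lambda>t g. t \<in> fst (F g))"
  proof
    fix t g h
    assume "t \<in> carrier (racg \<Gamma>)" "g \<in> carrier (racg \<Gamma>)" "h \<in> carrier (racg \<Gamma>)"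
    then show "t \<in> fst (F (g \<otimes>\<^bsub>racg \<Gamma>\<^esub> h)) \<longleftrightarrow>
        (t \<in> fst (F g)) \<noteq> (W.conjugate (inv\<^bsub>racg \<Gamma>\<^esub> g) t \<in> fst (F h))"
      using F snd_F[of g] by (simp add: hom_mult) (simp add: wall_group_def split_beta)
  next
    fix s a and n :: nat
    assume "s \<in> gen \<Gamma> ` verts \<Gamma>" "a \<in> gen \<Gamma> ` verts \<Gamma>"
      and nc: "s \<otimes>\<^bsub>racg \<Gamma>\<^esub> a \<noteq> a \<otimes>\<^bsub>racg \<Gamma>\<^esub> s" and "0 < n"
    then obtain u v where uv: "u \<in> verts \<Gamma>" "v \<in> verts \<Gamma>" "s = gen \<Gamma> u" "a = gen \<Gamma> v"
      by blast
    then have "v \<noteq> u \<and> {v, u} \<notin> edges \<Gamma>"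
      using nc gen_commute[of v \<Gamma> u] by metis
    then show "(a \<otimes>\<^bsub>racg \<Gamma>\<^esub> s) [^]\<^bsub>racg \<Gamma>\<^esub> n \<noteq> \<one>\<^bsub>racg \<Gamma>\<^esub>"
      using gen_mult_infinite_order[of v \<Gamma> u n] uv \<open>0 < n\<close> by metis
  qed (use F racg_generate in auto)
  then show ?thesis
    using that by blast
qed

section \<open>Equality and commutation of generators, involutive automorphisms\<close>

lemma gen_eq_iff:
  assumes "u \<in> verts \<Gamma>" "v \<in> verts \<Gamma>"
  shows "gen \<Gamma> u = gen \<Gamma> v \<longleftrightarrow> u = v"
proof
  assume eq: "gen \<Gamma> u = gen \<Gamma> v"
  have "\<exists>h\<in>hom (racg \<Gamma>) infinite_dihedral_group. \<forall>x\<in>verts \<Gamma>. h (gen \<Gamma> x) = (0, x = u)"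
    by (rule racg_hom_exists[OF group_infinite_dihedral_group])
      (auto simp: infinite_dihedral_group_def)
  then show "u = v"
    using assms eq by (metis prod.inject)
qed simp

lemma gen_commute_iff:
  assumes uv: "u \<in> verts \<Gamma>" "v \<in> verts \<Gamma>"
  shows "gen \<Gamma> u \<otimes>\<^bsub>racg \<Gamma>\<^esub> gen \<Gamma> v = gen \<Gamma> v \<otimes>\<^bsub>racg \<Gamma>\<^esub> gen \<Gamma> u \<longleftrightarrow> u = v \<or> {u, v} \<in> edges \<Gamma>"
proof
  interpret W: group "racg \<Gamma>" by (rule group_racg)
  assume comm: "gen \<Gamma> u \<otimes>\<^bsub>racg \<Gamma>\<^esub> gen \<Gamma> v = gen \<Gamma> v \<otimes>\<^bsub>racg \<Gamma>\<^esub> gen \<Gamma> u"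
  have "(gen \<Gamma> u \<otimes>\<^bsub>racg \<Gamma>\<^esub> gen \<Gamma> v) [^]\<^bsub>racg \<Gamma>\<^esub> (2::nat) =
      (gen \<Gamma> u \<otimes>\<^bsub>racg \<Gamma>\<^esub> gen \<Gamma> v) \<otimes>\<^bsub>racg \<Gamma>\<^esub> (gen \<Gamma> u \<otimes>\<^bsub>racg \<Gamma>\<^esub> gen \<Gamma> v)"
    using uv by (simp add: numeral_2_eq_2)
  also have "\<dots> = (gen \<Gamma> u \<otimes>\<^bsub>racg \<Gamma>\<^esub> gen \<Gamma> v) \<otimes>\<^bsub>racg \<Gamma>\<^esub> (gen \<Gamma> v \<otimes>\<^bsub>racg \<Gamma>\<^esub> gen \<Gamma> u)"
    by (simp only: comm)
  also have "\<dots> = \<one>\<^bsub>racg \<Gamma>\<^esub>"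
    using uv by (simp add: W.m_assoc W.involution_cancel)
  finally show "u = v \<or> {u, v} \<in> edges \<Gamma>"
    using gen_mult_infinite_order[OF uv, of 2] by auto
qed (metis gen_commute uv)

text \<open>An endomorphism whose square fixes the generators is its own inverse. The transvections
  and partial conjugations below are of this kind because generators are involutions.\<close>

lemma racg_involutive_auto:
  assumes f_closed: "\<And>u. u \<in> verts \<Gamma> \<Longrightarrow> f u \<in> carrier (racg \<Gamma>)"
    and f_sq: "\<And>u. u \<in> verts \<Gamma> \<Longrightarrow> f u \<otimes>\<^bsub>racg \<Gamma>\<^esub> f u = \<one>\<^bsub>racg \<Gamma>\<^esub>"
    and f_comm: "\<And>u v. u \<in> verts \<Gamma> \<Longrightarrow> v \<in> verts \<Gamma> \<Longrightarrow> {u, v} \<in> edges \<Gamma>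
      \<Longrightarrow> f u \<otimes>\<^bsub>racg \<Gamma>\<^esub> f v = f v \<otimes>\<^bsub>racg \<Gamma>\<^esub> f u"
    and involutive: "\<And>h u. h \<in> hom (racg \<Gamma>) (racg \<Gamma>) \<Longrightarrow> (\<And>v. v \<in> verts \<Gamma> \<Longrightarrow> h (gen \<Gamma> v) = f v)
      \<Longrightarrow> u \<in> verts \<Gamma> \<Longrightarrow> h (f u) = gen \<Gamma> u"
  shows "\<exists>\<alpha>\<in>auto (racg \<Gamma>). \<forall>u\<in>verts \<Gamma>. \<alpha> (gen \<Gamma> u) = f u"
proof -
  interpret W: group "racg \<Gamma>" by (rule group_racg)
  have "\<exists>h\<in>hom (racg \<Gamma>) (racg \<Gamma>). \<forall>u\<in>verts \<Gamma>. h (gen \<Gamma> u) = f u"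
    by (rule racg_hom_exists[OF group_racg f_closed f_sq f_comm])
  then obtain h where h: "h \<in> hom (racg \<Gamma>) (racg \<Gamma>)" "\<And>u. u \<in> verts \<Gamma> \<Longrightarrow> h (gen \<Gamma> u) = f u"
    by blast
  have homs: "(\<lambda>g. h (h g)) \<in> hom (racg \<Gamma>) (racg \<Gamma>)" "(\<lambda>g. g) \<in> hom (racg \<Gamma>) (racg \<Gamma>)"
    using h by (auto simp: hom_def Pi_iff)
  have hh: "h (h g) = g" if "g \<in> carrier (racg \<Gamma>)" for g
    by (rule racg_hom_eq[OF group_racg homs _ that]) (simp add: h(2) involutive[OF h])
  have closed: "h g \<in> carrier (racg \<Gamma>)" if "g \<in> carrier (racg \<Gamma>)" for g
    using h that by (meson hom_in_carrier)
  have "bij_betw h (carrier (racg \<Gamma>)) (carrier (racg \<Gamma>))"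
    using hh closed by (intro bij_betwI[where g = h]) auto
  \<comment> \<open>Members of \<open>auto\<close> are extensional functions on the carrier, hence
    the restriction.\<close>
  then have "restrict h (carrier (racg \<Gamma>)) \<in> auto (racg \<Gamma>)"
    using h closed by (auto simp: auto_def Bij_def hom_def)
  then show ?thesis
    using h by (intro bexI[of _ "restrict h (carrier (racg \<Gamma>))"]) auto
qed

lemma (in group) compose_auto:
  assumes "\<alpha> \<in> auto G" "\<beta> \<in> auto G"
  shows "compose (carrier G) \<alpha> \<beta> \<in> auto G"
  using subgroup.m_closed[OF subgroup_auto assms] assms by (simp add: BijGroup_def auto_def)

section \<open>Hyperplanes\<close>

locale racg_walls = wall_system "racg \<Gamma>" "gen \<Gamma> ` verts \<Gamma>" sep
  for \<Gamma> :: "'a graph" and sep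
begin

abbreviation W where "W \<equiv> racg \<Gamma>"

lemma triangle_free_two_dimensional:
  assumes "triangle_free \<Gamma>"
  shows "two_dimensional"
  unfolding two_dimensional_def
proof (clarify)
  fix u v w
  assume uvw: "u \<in> verts \<Gamma>" "v \<in> verts \<Gamma>" "w \<in> verts \<Gamma>"
    and "gen \<Gamma> u \<noteq> gen \<Gamma> v" "gen \<Gamma> u \<noteq> gen \<Gamma> w" "gen \<Gamma> v \<noteq> gen \<Gamma> w"
    and "gen \<Gamma> u \<otimes>\<^bsub>W\<^esub> gen \<Gamma> v = gen \<Gamma> v \<otimes>\<^bsub>W\<^esub> gen \<Gamma> u"
    and "gen \<Gamma> u \<otimes>\<^bsub>W\<^esub> gen \<Gamma> w = gen \<Gamma> w \<otimes>\<^bsub>W\<^esub> gen \<Gamma> u"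
    and "gen \<Gamma> v \<otimes>\<^bsub>W\<^esub> gen \<Gamma> w = gen \<Gamma> w \<otimes>\<^bsub>W\<^esub> gen \<Gamma> v"
  then have "{u, v} \<in> edges \<Gamma>" "{v, w} \<in> edges \<Gamma>" "{u, w} \<in> edges \<Gamma>"
    by (auto simp: gen_commute_iff)
  then show False
    using assms unfolding triangle_free_def by blast
qed

section \<open>Edges, squares and their reflections\<close>

lemma cayley_edges_iff:
  "e \<in> cayley_edges \<Gamma> \<longleftrightarrow> (\<exists>g\<in>carrier W. \<exists>s\<in>gen \<Gamma> ` verts \<Gamma>. e = {g, g \<otimes>\<^bsub>W\<^esub> s})"
  unfolding cayley_edges_def by blast

text \<open>Since \<open>conjugate g s \<otimes> g = g \<otimes> s\<close>, these are the edges
  inverted by the reflection \<open>t\<close>.\<close>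

definition on_wall :: "'a word set \<Rightarrow> 'a word set set \<Rightarrow> bool" where
  "on_wall t e \<longleftrightarrow> (\<exists>g\<in>carrier W. \<exists>s\<in>gen \<Gamma> ` verts \<Gamma>. e = {g, g \<otimes>\<^bsub>W\<^esub> s} \<and> t = conjugate g s)"

lemma on_wall_refl: "on_wall t e \<Longrightarrow> refl t"
  unfolding on_wall_def refl_def by blast

lemma on_wallD:
  assumes "on_wall t {x, y}"
  shows "x \<in> carrier W" "y \<in> carrier W" "y = t \<otimes>\<^bsub>W\<^esub> x" "q \<in> carrier W \<Longrightarrow> sep q y \<longleftrightarrow> sep q x \<noteq> (q = t)"
proof -
  obtain g s where gs: "g \<in> carrier W" "s \<in> gen \<Gamma> ` verts \<Gamma>" "{x, y} = {g, g \<otimes>\<^bsub>W\<^esub> s}" "t = conjugate g s"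
    using assms unfolding on_wall_def by blast
  then have xy: "(x, y) = (g, t \<otimes>\<^bsub>W\<^esub> g) \<or> (x, y) = (t \<otimes>\<^bsub>W\<^esub> g, g)"
    by (auto simp: doubleton_eq_iff conjugate_mult_self)
  have t: "refl t" "t \<in> carrier W"
    using gs reflI refl_closed by auto
  then show "x \<in> carrier W" "y \<in> carrier W" "y = t \<otimes>\<^bsub>W\<^esub> x"
    using xy gs(1) by (auto simp: involution_cancel refl_sq)
  show "sep q y \<longleftrightarrow> sep q x \<noteq> (q = t)" if "q \<in> carrier W"
    using xy gs that by (auto simp: conjugate_mult_self sep_mult_gen)
qed

lemma on_wall_exists:
  assumes "e \<in> cayley_edges \<Gamma>"
  obtains t where "on_wall t e"
  using assms that unfolding cayley_edges_iff on_wall_def by blast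

text \<open>A tour around the square crosses every wall an even number of times, and consecutive
  edges have distinct reflections because opposite corners differ; so opposite edges share
  theirs.\<close>

lemma square_walls:
  assumes "square \<Gamma> a b c d"
  obtains t t' where "on_wall t {a, b}" "on_wall t {c, d}" "on_wall t' {b, c}" "on_wall t' {d, a}" "t \<noteq> t'"
proof -
  have ne: "a \<noteq> c" "b \<noteq> d" and ed: "{a, b} \<in> cayley_edges \<Gamma>" "{b, c} \<in> cayley_edges \<Gamma>"
      "{c, d} \<in> cayley_edges \<Gamma>" "{d, a} \<in> cayley_edges \<Gamma>"
    using assms unfolding square_def by auto
  obtain t1 t2 t3 t4 where t: "on_wall t1 {a, b}" "on_wall t2 {b, c}" "on_wall t3 {c, d}" "on_wall t4 {d, a}"
    using ed on_wall_exists by metis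
  have refl: "refl t1" "refl t2" "refl t3" "refl t4"
    using t on_wall_refl by auto
  have "t1 \<noteq> t2"
    using ne(1) on_wallD(1,3)[OF t(1)] on_wallD(1,3)[OF t(2)] refl
    by (auto simp: involution_cancel refl_closed refl_sq)
  moreover have "t4 \<noteq> t1"
    using ne(2) on_wallD(1,3)[OF t(4)] on_wallD(1,3)[OF t(1)] refl
    by (auto simp: involution_cancel refl_closed refl_sq)
  moreover have "((q = t1) \<noteq> (q = t2)) \<longleftrightarrow> ((q = t3) \<noteq> (q = t4))" if "q \<in> carrier W" for q
    using that t[THEN on_wallD(4), of q] by blast
  ultimately have "t1 = t3" "t2 = t4"
    using refl refl_closed by metis+
  then show ?thesis
    using that t \<open>t1 \<noteq> t2\<close> by auto
qed

lemma on_wall_unique: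
  assumes "on_wall t e" "on_wall t' e"
  shows "t = t'"
proof -
  obtain g s where "g \<in> carrier W" "s \<in> gen \<Gamma> ` verts \<Gamma>" "e = {g, g \<otimes>\<^bsub>W\<^esub> s}"
    using assms(1) unfolding on_wall_def by blast
  then show ?thesis
    using on_wallD(3)[of t g "g \<otimes>\<^bsub>W\<^esub> s"] on_wallD(3)[of t' g "g \<otimes>\<^bsub>W\<^esub> s"] assms
    by (metis on_wall_refl refl_closed right_cancel)
qed

lemma opposite_on_wall:
  assumes "opposite \<Gamma> e f"
  shows "on_wall t e \<longleftrightarrow> on_wall t f"
proof -
  obtain a b c d where "square \<Gamma> a b c d" "e = {a, b}" "f = {c, d}"
    using assms unfolding opposite_def by blast
  then show ?thesis
    using square_walls on_wall_unique by metis
qed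

lemma equivclp_opposite_on_wall:
  assumes "equivclp (opposite \<Gamma>) e f"
  shows "on_wall t e \<longleftrightarrow> on_wall t f"
  using assms by (induction rule: equivclp_induct) (auto simp: opposite_on_wall)

lemma hyperplane_class:
  assumes "J \<in> hyperplanes \<Gamma>" "e \<in> J"
  shows "J = {f \<in> cayley_edges \<Gamma>. equivclp (opposite \<Gamma>) e f}"
  using assms unfolding hyperplanes_def by (auto intro: equivclp_trans equivclp_sym)

text \<open>One inclusion holds because opposite edges have the same reflection. For the other, each
  step of the strip from \<open>wall_induct\<close> passes to the opposite edge of a square and so
  stays in \<open>J\<close>.\<close>

lemma hyperplane_on_wall:
  assumes J: "J \<in> hyperplanes \<Gamma>" "e \<in> J" and e: "on_wall t e"
  shows "J = {f. on_wall t f}"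
proof (intro equalityI subsetI CollectI)
  show "on_wall t f" if "f \<in> J" for f
    using hyperplane_class[OF J] that e equivclp_opposite_on_wall by blast
next
  fix f assume "f \<in> {f. on_wall t f}"
  then obtain h s' where h: "h \<in> carrier W" "s' \<in> gen \<Gamma> ` verts \<Gamma>" "f = {h, h \<otimes>\<^bsub>W\<^esub> s'}" "t = conjugate h s'"
    unfolding on_wall_def by blast
  obtain g s where g: "g \<in> carrier W" "s \<in> gen \<Gamma> ` verts \<Gamma>" "e = {g, g \<otimes>\<^bsub>W\<^esub> s}" "t = conjugate g s"
    using e unfolding on_wall_def by blast
  have "s' = s \<and> {h, h \<otimes>\<^bsub>W\<^esub> s} \<in> J"
  proof (rule wall_induct[OF g(1) h(1) g(2) h(2)])
    show "conjugate g s = conjugate h s'"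
      using g h by simp
    show "{g, g \<otimes>\<^bsub>W\<^esub> s} \<in> J"
      using g J by simp
    then show "{g \<otimes>\<^bsub>W\<^esub> s, g \<otimes>\<^bsub>W\<^esub> s \<otimes>\<^bsub>W\<^esub> s} \<in> J"
      using g by (simp add: insert_commute)
  next
    fix k a
    assume k: "k \<in> carrier W" "{k, k \<otimes>\<^bsub>W\<^esub> s} \<in> J"
      and a: "a \<in> gen \<Gamma> ` verts \<Gamma>" "a \<noteq> s" "a \<otimes>\<^bsub>W\<^esub> s = s \<otimes>\<^bsub>W\<^esub> a"
    have one: "s \<noteq> \<one>\<^bsub>W\<^esub>" "a \<noteq> \<one>\<^bsub>W\<^esub>"
      using sep_gen[of s s] sep_gen[of a a] a g by auto
    have sa: "s \<otimes>\<^bsub>W\<^esub> a \<noteq> \<one>\<^bsub>W\<^esub>"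
      using a g S_inv inv_equality by (metis S_closed)
    have "k \<otimes>\<^bsub>W\<^esub> a \<otimes>\<^bsub>W\<^esub> s = k \<otimes>\<^bsub>W\<^esub> s \<otimes>\<^bsub>W\<^esub> a"
      using k a g by (metis S_closed m_assoc)
    moreover have "distinct [k, k \<otimes>\<^bsub>W\<^esub> s, k \<otimes>\<^bsub>W\<^esub> a \<otimes>\<^bsub>W\<^esub> s, k \<otimes>\<^bsub>W\<^esub> a]"
      using one sa a g k by (auto simp: m_assoc)
    ultimately have "square \<Gamma> k (k \<otimes>\<^bsub>W\<^esub> s) (k \<otimes>\<^bsub>W\<^esub> a \<otimes>\<^bsub>W\<^esub> s) (k \<otimes>\<^bsub>W\<^esub> a)"
      unfolding square_def cayley_edges_iff insert_subset using k a g
      by (auto simp: cayley_edges_iff)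
    then have "opposite \<Gamma> {k, k \<otimes>\<^bsub>W\<^esub> s} {k \<otimes>\<^bsub>W\<^esub> a, k \<otimes>\<^bsub>W\<^esub> a \<otimes>\<^bsub>W\<^esub> s}"
      unfolding opposite_def
      using insert_commute[of "k \<otimes>\<^bsub>W\<^esub> a" "k \<otimes>\<^bsub>W\<^esub> a \<otimes>\<^bsub>W\<^esub> s" "{}"] by blast
    moreover have "{k \<otimes>\<^bsub>W\<^esub> a, k \<otimes>\<^bsub>W\<^esub> a \<otimes>\<^bsub>W\<^esub> s} \<in> cayley_edges \<Gamma>"
      using k a g unfolding cayley_edges_iff by blast
    ultimately show "{k \<otimes>\<^bsub>W\<^esub> a, k \<otimes>\<^bsub>W\<^esub> a \<otimes>\<^bsub>W\<^esub> s} \<in> J"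
      using hyperplane_class[OF J(1) k(2)] by auto
  qed
  then show "f \<in> J" using h by simp
qed

section \<open>Halfspaces and separation from 1\<close>

text \<open>Going back from \<open>g\<close> along right descents traces a geodesic to 1. Each of
  its edges crosses a wall separating its outer endpoint from 1, hence never the wall of
  \<open>r\<close>.\<close>

lemma path_from_one:
  assumes "g \<in> carrier W" "r \<in> carrier W" "\<not> sep r g"
  shows "(\<lambda>x y. {x, y} \<in> cayley_edges \<Gamma> - {f. on_wall r f})\<^sup>*\<^sup>* \<one>\<^bsub>W\<^esub> g"
  using assms
proof (induction "len g" arbitrary: g rule: less_induct)
  case less
  show ?case
  proof (cases "g = \<one>\<^bsub>W\<^esub>")
    case False
    then obtain s where s: "s \<in> gen \<Gamma> ` verts \<Gamma>" "sep (conjugate g s) g"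
      using right_descent less by metis
    have "r \<noteq> conjugate g s"
      using s less by auto
    moreover have wall: "on_wall (conjugate g s) {g, g \<otimes>\<^bsub>W\<^esub> s}"
      using s less unfolding on_wall_def by blast
    ultimately have "{g \<otimes>\<^bsub>W\<^esub> s, g} \<in> cayley_edges \<Gamma> - {f. on_wall r f}"
      using on_wall_unique s less by (auto simp: insert_commute cayley_edges_iff)
    moreover have "\<not> sep r (g \<otimes>\<^bsub>W\<^esub> s)"
      using s less \<open>r \<noteq> conjugate g s\<close> by (simp add: sep_mult_gen)
    then have "(\<lambda>x y. {x, y} \<in> cayley_edges \<Gamma> - {f. on_wall r f})\<^sup>*\<^sup>* \<one>\<^bsub>W\<^esub> (g \<otimes>\<^bsub>W\<^esub> s)"
      using less len_right_less[of g s] s by simp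
    ultimately show ?thesis
      by (rule rtranclp.rtrancl_into_rtrancl[rotated])
  qed simp
qed

text \<open>By \<open>path_from_one\<close>, a vertex on the side of 1 is joined to 1 off the wall,
  which would put 1 into the component \<open>H\<close>.\<close>

lemma halfspace_sep:
  assumes r: "r \<in> carrier W" and H: "H \<in> halfspaces \<Gamma> {f. on_wall r f}" "\<one>\<^bsub>W\<^esub> \<notin> H" and h: "h \<in> H"
  shows "sep r h"
proof (rule ccontr)
  let ?R = "\<lambda>x y. {x, y} \<in> cayley_edges \<Gamma> - {f. on_wall r f}"
  obtain g where g: "H = {h \<in> carrier W. ?R\<^sup>*\<^sup>* g h}"
    using H unfolding halfspaces_def by blast
  assume "\<not> sep r h"
  then have "?R\<^sup>*\<^sup>* \<one>\<^bsub>W\<^esub> h"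
    using path_from_one r g h by blast
  moreover have "symp ?R\<^sup>*\<^sup>*"
    by (intro symp_rtranclp sympI) (simp add: insert_commute)
  ultimately have "?R\<^sup>*\<^sup>* h \<one>\<^bsub>W\<^esub>"
    by (rule sympD[rotated])
  then show False
    using rtranclp_trans[of ?R g h "\<one>\<^bsub>W\<^esub>"] g h H(2) by simp
qed

lemma reflection_along_iff:
  "reflection_along \<Gamma> r J \<longleftrightarrow> J \<in> hyperplanes \<Gamma> \<and> refl r \<and> J = {f. on_wall r f}"
proof
  assume "reflection_along \<Gamma> r J"
  then obtain g u where "J \<in> hyperplanes \<Gamma>" "g \<in> carrier W" "u \<in> verts \<Gamma>" "r = conjugate g (gen \<Gamma> u)"
      "{g, g \<otimes>\<^bsub>W\<^esub> gen \<Gamma> u} \<in> J"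
    unfolding reflection_along_def conjugate_def by blast
  moreover from this have "on_wall r {g, g \<otimes>\<^bsub>W\<^esub> gen \<Gamma> u}"
    unfolding on_wall_def by blast
  ultimately show "J \<in> hyperplanes \<Gamma> \<and> refl r \<and> J = {f. on_wall r f}"
    using hyperplane_on_wall on_wall_refl by blast
next
  assume "J \<in> hyperplanes \<Gamma> \<and> refl r \<and> J = {f. on_wall r f}"
  then show "reflection_along \<Gamma> r J"
    unfolding reflection_along_def refl_def on_wall_def conjugate_def by blast
qed

lemma reflection_iff: "reflection \<Gamma> r \<longleftrightarrow> refl r"
  unfolding reflection_def refl_def conjugate_def by blast

text \<open>The reflections cannot commute: otherwise \<open>r\<close> would preserve the wall of
  \<open>t\<close> while exchanging its own sides, so that wall could not lie on one side of
  \<open>r\<close>.\<close>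

lemma separates_beyond:
  assumes along: "reflection_along \<Gamma> r J" "reflection_along \<Gamma> t K" and "separates_from_one \<Gamma> J K"
  shows "r \<otimes>\<^bsub>W\<^esub> t \<noteq> t \<otimes>\<^bsub>W\<^esub> r \<and> beyond r t"
proof -
  have r: "refl r" "J = {f. on_wall r f}" and t: "refl t" "K = {f. on_wall t f}"
    using along by (auto simp: reflection_along_iff)
  obtain H where H: "H \<in> halfspaces \<Gamma> J" "\<one>\<^bsub>W\<^esub> \<notin> H" "\<Union>K \<subseteq> H"
    using assms(3) unfolding separates_from_one_def by blast
  have sep: "sep r x" if "on_wall t {x, y}" for x y
    using halfspace_sep[of r H x] H that r t refl_closed by blast
  have beyond: "beyond r t"
    unfolding beyond_def
  proof (intro ballI impI)
    fix g s assume "g \<in> carrier W" "s \<in> gen \<Gamma> ` verts \<Gamma>" "conjugate g s = t"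
    then show "sep r g"
      by (intro sep[of g "g \<otimes>\<^bsub>W\<^esub> s"]) (auto simp: on_wall_def)
  qed
  have "r \<otimes>\<^bsub>W\<^esub> t \<noteq> t \<otimes>\<^bsub>W\<^esub> r"
  proof
    assume comm: "r \<otimes>\<^bsub>W\<^esub> t = t \<otimes>\<^bsub>W\<^esub> r"
    obtain g s where g: "g \<in> carrier W" "s \<in> gen \<Gamma> ` verts \<Gamma>" "t = conjugate g s"
      using t unfolding refl_def by blast
    have "conjugate (r \<otimes>\<^bsub>W\<^esub> g) s = t"
      using r g t comm by (metis S_closed conjugate_conj conjugate_eq_self_iff refl_closed)
    then have "sep r (r \<otimes>\<^bsub>W\<^esub> g)" "sep r g"
      using beyond g(1,2) r g(3)[symmetric] refl_closed unfolding beyond_def by (blast intro: m_closed)+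
    then show False
      using sep_refl_mult r g by simp
  qed
  with beyond show ?thesis by simp
qed

end

section \<open>Precomposition by automorphisms\<close>

text \<open>The wall of \<open>s\<close> separates 1 from \<open>s \<otimes> a\<close>, but only its
  own wall separates 1 from a generator. This will rule out a second neighbour of a leaf.\<close>

lemma (in wall_system) gen_mult_not_gen:
  assumes "s \<in> S" "a \<in> S" "c \<in> S" "s \<noteq> a"
  shows "s \<otimes> a \<noteq> c"
proof
  assume c: "s \<otimes> a = c"
  have "conjugate s a \<noteq> s"
    using assms conjugate_inject[of s a s] by auto
  then have "sep s (s \<otimes> a)"
    using assms by (simp add: sep_mult_gen sep_gen)
  then have "s \<otimes> a = s"
    using assms c by (simp add: sep_gen)
  then have "a = \<one>"
    using assms by simp
  then show False
    using assms sep_gen[of a a] by simp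
qed

text \<open>
  A vertex whose image is not a reflection maps to a product of two commuting reflections, whose
  centralizer is too small to leave room for a second neighbour. Such leaves are corrected by
  transvections.
\<close>

lemma (in racg_walls) leaf_of_non_reflection:
  fixes \<Phi> :: "'b graph"
  assumes rho: "\<rho> \<in> mon (racg \<Phi>) W" and two: "two_dimensional" and \<Phi>: "simplicial_graph \<Phi>"
    and no_isolated: "\<not> (\<exists>v. isolated_vertex \<Phi> v)"
    and u: "u \<in> verts \<Phi>" "\<not> refl (\<rho> (gen \<Phi> u))"
  shows "\<exists>v. v \<in> verts \<Phi> \<and> {u, v} \<in> edges \<Phi> \<and> (\<forall>w. {u, w} \<in> edges \<Phi> \<longrightarrow> w = v) \<and>
    refl (\<rho> (gen \<Phi> v)) \<and> refl (\<rho> (gen \<Phi> u) \<otimes>\<^bsub>W\<^esub> \<rho> (gen \<Phi> v))"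
proof -
  obtain sep' where "wall_system (racg \<Phi>) (gen \<Phi> ` verts \<Phi>) sep'"
    by (rule racg_wall_system)
  then interpret P: wall_system "racg \<Phi>" "gen \<Phi> ` verts \<Phi>" sep' .
  interpret rho: group_hom "racg \<Phi>" W \<rho>
    using rho group_racg by (auto simp: group_hom_def group_hom_axioms_def mon_def)
  have inj: "\<rho> x = \<rho> y \<longleftrightarrow> x = y" if "x \<in> carrier (racg \<Phi>)" "y \<in> carrier (racg \<Phi>)" for x y
    using rho that by (auto simp: mon_def inj_on_def)
  have gen_ne_one: "gen \<Phi> x \<noteq> \<one>\<^bsub>racg \<Phi>\<^esub>" if "x \<in> verts \<Phi>" for x
    using P.sep_gen[of "gen \<Phi> x" "gen \<Phi> x"] that by auto
  have vert: "w \<in> verts \<Phi> \<and> u \<noteq> w" if "{u, w} \<in> edges \<Phi>" for w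
    using \<Phi> that unfolding simplicial_graph_def by (auto simp: doubleton_eq_iff)
  have closed: "\<rho> (gen \<Phi> u) \<in> carrier W"
    using u by simp
  have ne_one: "\<rho> (gen \<Phi> u) \<noteq> \<one>\<^bsub>W\<^esub>"
    using inj[of "gen \<Phi> u" "\<one>\<^bsub>racg \<Phi>\<^esub>"] gen_ne_one u by simp
  have sq: "\<rho> (gen \<Phi> u) \<otimes>\<^bsub>W\<^esub> \<rho> (gen \<Phi> u) = \<one>\<^bsub>W\<^esub>"
    using u by (simp flip: rho.hom_mult)
  obtain g s a where g: "g \<in> carrier W" and s: "s \<in> gen \<Gamma> ` verts \<Gamma>"
    and a: "a \<in> gen \<Gamma> ` verts \<Gamma>" and sa: "s \<noteq> a" "s \<otimes>\<^bsub>W\<^esub> a = a \<otimes>\<^bsub>W\<^esub> s"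
    and image: "\<rho> (gen \<Phi> u) = conjugate g (s \<otimes>\<^bsub>W\<^esub> a)"
    using involution_cases[OF two closed ne_one sq] u(2) by blast
  \<comment> \<open>The image of a neighbour centralizes that of \<open>u\<close>; injectivity
    excludes the identity and the image of \<open>u\<close> from the four candidates.\<close>
  have nbr: "\<rho> (gen \<Phi> w) \<in> {conjugate g s, conjugate g a}" if w: "{u, w} \<in> edges \<Phi>" for w
  proof -
    define y where "y = conjugate (inv\<^bsub>W\<^esub> g) (\<rho> (gen \<Phi> w))"
    have y: "y \<in> carrier W" "\<rho> (gen \<Phi> w) = conjugate g y"
      using vert[OF w] g by (simp_all add: y_def)
    have "\<rho> (gen \<Phi> u) \<otimes>\<^bsub>W\<^esub> \<rho> (gen \<Phi> w) = \<rho> (gen \<Phi> w) \<otimes>\<^bsub>W\<^esub> \<rho> (gen \<Phi> u)"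
      using u vert[OF w] gen_commute[of u \<Phi> w] w by (simp flip: rho.hom_mult)
    then have "y \<otimes>\<^bsub>W\<^esub> (s \<otimes>\<^bsub>W\<^esub> a) = s \<otimes>\<^bsub>W\<^esub> a \<otimes>\<^bsub>W\<^esub> y"
      using g s a y image conjugate_commute_iff[of g "s \<otimes>\<^bsub>W\<^esub> a" y] by auto
    then have "y \<in> {\<one>\<^bsub>W\<^esub>, s, a, s \<otimes>\<^bsub>W\<^esub> a}"
      using centralizer_edge[OF two s a sa y(1)] by simp
    moreover have "y \<noteq> \<one>\<^bsub>W\<^esub>"
      using y g inj[of "gen \<Phi> w" "\<one>\<^bsub>racg \<Phi>\<^esub>"] gen_ne_one vert[OF w] by auto
    moreover have "y \<noteq> s \<otimes>\<^bsub>W\<^esub> a"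
      using y image inj[of "gen \<Phi> w" "gen \<Phi> u"] vert[OF w] u by (auto simp: gen_eq_iff)
    ultimately show ?thesis
      using y by blast
  qed
  obtain v where v: "{u, v} \<in> edges \<Phi>"
    using no_isolated u unfolding isolated_vertex_def by blast
  \<comment> \<open>Two neighbours would map to the two factors, so by injectivity
    \<open>gen \<Phi> u\<close> would be a product of two generators.\<close>
  have "w = v" if w: "{u, w} \<in> edges \<Phi>" for w
  proof (rule ccontr)
    assume "w \<noteq> v"
    then have "\<rho> (gen \<Phi> w) \<noteq> \<rho> (gen \<Phi> v)"
      using inj vert[OF v] vert[OF w] by (simp add: gen_eq_iff)
    then have "\<rho> (gen \<Phi> w) \<otimes>\<^bsub>W\<^esub> \<rho> (gen \<Phi> v) = conjugate g (s \<otimes>\<^bsub>W\<^esub> a)"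
      using nbr[OF v] nbr[OF w] g s a sa by (auto simp: conjugate_mult[symmetric])
    then have "\<rho> (gen \<Phi> w \<otimes>\<^bsub>racg \<Phi>\<^esub> gen \<Phi> v) = \<rho> (gen \<Phi> u)"
      using vert[OF v] vert[OF w] image by simp
    then have "gen \<Phi> w \<otimes>\<^bsub>racg \<Phi>\<^esub> gen \<Phi> v = gen \<Phi> u"
      using inj[of "gen \<Phi> w \<otimes>\<^bsub>racg \<Phi>\<^esub> gen \<Phi> v" "gen \<Phi> u"] vert[OF v] vert[OF w] u by simp
    then show False
      using P.gen_mult_not_gen[of "gen \<Phi> w" "gen \<Phi> v" "gen \<Phi> u"] vert[OF v] vert[OF w] u \<open>w \<noteq> v\<close>
      by (simp add: gen_eq_iff)
  qed
  moreover have "refl (\<rho> (gen \<Phi> v))"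
    using nbr[OF v] g s a reflI by auto
  moreover have "s \<otimes>\<^bsub>W\<^esub> a \<otimes>\<^bsub>W\<^esub> s = a" "s \<otimes>\<^bsub>W\<^esub> a \<otimes>\<^bsub>W\<^esub> a = s"
    using s a by (simp add: sa(2), simp)
  then have "conjugate g (s \<otimes>\<^bsub>W\<^esub> a) \<otimes>\<^bsub>W\<^esub> conjugate g s = conjugate g a"
      "conjugate g (s \<otimes>\<^bsub>W\<^esub> a) \<otimes>\<^bsub>W\<^esub> conjugate g a = conjugate g s"
    using g s a by (simp_all flip: conjugate_mult)
  then have "refl (\<rho> (gen \<Phi> u) \<otimes>\<^bsub>W\<^esub> \<rho> (gen \<Phi> v))"
    using nbr[OF v] g s a reflI unfolding image by auto
  ultimately show ?thesis
    using v vert[OF v] by blast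
qed

text \<open>All bad leaves can be corrected simultaneously: the neighbour of a bad vertex is not
  bad, so its generator stays fixed and the correction is an involution.\<close>

lemma (in racg_walls) generators_to_reflections:
  fixes \<Phi> :: "'b graph"
  assumes rho: "\<rho> \<in> mon (racg \<Phi>) W" and two: "two_dimensional" and \<Phi>: "simplicial_graph \<Phi>"
    and no_isolated: "\<not> (\<exists>v. isolated_vertex \<Phi> v)"
  shows "\<exists>\<alpha>\<in>auto (racg \<Phi>). \<forall>u\<in>verts \<Phi>. refl (\<rho> (\<alpha> (gen \<Phi> u)))"
proof -
  interpret P: group "racg \<Phi>" by (rule group_racg)
  have hom: "\<rho> \<in> hom (racg \<Phi>) W"
    using rho by (simp add: mon_def)
  define bad where "bad u \<longleftrightarrow> \<not> refl (\<rho> (gen \<Phi> u))" for u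
  have "\<forall>u\<in>{u \<in> verts \<Phi>. bad u}. \<exists>v. v \<in> verts \<Phi> \<and> {u, v} \<in> edges \<Phi> \<and>
      (\<forall>w. {u, w} \<in> edges \<Phi> \<longrightarrow> w = v) \<and> \<not> bad v \<and> refl (\<rho> (gen \<Phi> u) \<otimes>\<^bsub>W\<^esub> \<rho> (gen \<Phi> v))"
    using leaf_of_non_reflection[OF assms] unfolding bad_def by blast
  from bchoice[OF this] obtain nb where
      "\<forall>u\<in>{u \<in> verts \<Phi>. bad u}. nb u \<in> verts \<Phi> \<and> {u, nb u} \<in> edges \<Phi> \<and>
        (\<forall>w. {u, w} \<in> edges \<Phi> \<longrightarrow> w = nb u) \<and> \<not> bad (nb u) \<and>
        refl (\<rho> (gen \<Phi> u) \<otimes>\<^bsub>W\<^esub> \<rho> (gen \<Phi> (nb u)))" ..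
  then have nb: "nb u \<in> verts \<Phi>" "{u, nb u} \<in> edges \<Phi>" "\<not> bad (nb u)"
      "refl (\<rho> (gen \<Phi> u) \<otimes>\<^bsub>W\<^esub> \<rho> (gen \<Phi> (nb u)))"
    and nb_unique: "\<And>w. {u, w} \<in> edges \<Phi> \<Longrightarrow> w = nb u" if "u \<in> verts \<Phi>" "bad u" for u
    using that by blast+
  define f where "f u = (if bad u then gen \<Phi> u \<otimes>\<^bsub>racg \<Phi>\<^esub> gen \<Phi> (nb u) else gen \<Phi> u)" for u
  have comm: "gen \<Phi> u \<otimes>\<^bsub>racg \<Phi>\<^esub> gen \<Phi> (nb u) = gen \<Phi> (nb u) \<otimes>\<^bsub>racg \<Phi>\<^esub> gen \<Phi> u"
    if "u \<in> verts \<Phi>" "bad u" for u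
    using that nb[OF that] by (intro gen_commute)
  have cancel: "gen \<Phi> v \<otimes>\<^bsub>racg \<Phi>\<^esub> (gen \<Phi> v \<otimes>\<^bsub>racg \<Phi>\<^esub> x) = x"
    if "v \<in> verts \<Phi>" "x \<in> carrier (racg \<Phi>)" for v x
    using that by (simp add: P.involution_cancel)
  have "\<exists>\<alpha>\<in>auto (racg \<Phi>). \<forall>u\<in>verts \<Phi>. \<alpha> (gen \<Phi> u) = f u"
  proof (rule racg_involutive_auto)
    fix u assume u: "u \<in> verts \<Phi>"
    then show "f u \<in> carrier (racg \<Phi>)"
      using nb by (auto simp: f_def)
    show "f u \<otimes>\<^bsub>racg \<Phi>\<^esub> f u = \<one>\<^bsub>racg \<Phi>\<^esub>"
    proof (cases "bad u")
      case True
      then have "f u \<otimes>\<^bsub>racg \<Phi>\<^esub> f u = gen \<Phi> u \<otimes>\<^bsub>racg \<Phi>\<^esub> gen \<Phi> (nb u) \<otimes>\<^bsub>racg \<Phi>\<^esub>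
          (gen \<Phi> (nb u) \<otimes>\<^bsub>racg \<Phi>\<^esub> gen \<Phi> u)"
        using comm[OF u True] by (simp add: f_def)
      then show ?thesis
        using u nb[OF u True] by (simp add: P.m_assoc cancel)
    qed (use u in \<open>simp add: f_def\<close>)
    fix v assume v: "v \<in> verts \<Phi>" "{u, v} \<in> edges \<Phi>"
    \<comment> \<open>The only commutation relation involving a leaf is the one with
      \<open>nb u\<close>, and it survives the transvection.\<close>
    have f_nb: "f u \<otimes>\<^bsub>racg \<Phi>\<^esub> gen \<Phi> (nb u) = gen \<Phi> (nb u) \<otimes>\<^bsub>racg \<Phi>\<^esub> f u"
      if "u \<in> verts \<Phi>" "bad u" for u
      using nb[OF that] that comm[OF that] unfolding f_def
      by simp (metis P.m_assoc gen_closed)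
    show "f u \<otimes>\<^bsub>racg \<Phi>\<^esub> f v = f v \<otimes>\<^bsub>racg \<Phi>\<^esub> f u"
    proof (cases "bad u \<or> bad v")
      case True
      then show ?thesis
      proof
        assume b: "bad u"
        then have "v = nb u" "f v = gen \<Phi> v"
          using nb[OF u b] nb_unique[OF u b v(2)] by (simp_all add: f_def)
        then show ?thesis using f_nb[OF u b] by simp
      next
        assume b: "bad v"
        then have "u = nb v" "f u = gen \<Phi> u"
          using nb[OF v(1) b] nb_unique[OF v(1) b, of u] v(2) by (simp_all add: f_def insert_commute)
        then show ?thesis using f_nb[OF v(1) b] by simp
      qed
    next
      case False
      then show ?thesis using u v gen_commute by (metis f_def)
    qed
  next
    fix h u
    assume h: "h \<in> hom (racg \<Phi>) (racg \<Phi>)" "\<And>v. v \<in> verts \<Phi> \<Longrightarrow> h (gen \<Phi> v) = f v"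
      and u: "u \<in> verts \<Phi>"
    show "h (f u) = gen \<Phi> u"
    proof (cases "bad u")
      case True
      then have "h (f u) = f u \<otimes>\<^bsub>racg \<Phi>\<^esub> f (nb u)"
        using h u nb[OF u True] hom_mult[OF h(1), of "gen \<Phi> u" "gen \<Phi> (nb u)"]
        by (simp add: f_def[of u])
      also have "\<dots> = gen \<Phi> u"
        using u nb[OF u True] True by (simp add: f_def P.m_assoc)
      finally show ?thesis .
    qed (use h u in \<open>simp add: f_def\<close>)
  qed
  moreover have "refl (\<rho> (f u))" if "u \<in> verts \<Phi>" for u
    using nb[OF that] that hom by (cases "bad u") (simp_all add: f_def hom_mult, simp add: bad_def)
  ultimately show ?thesis
    by metis
qed

text \<open>
  Adjacent vertices have transverse walls, so outside the star of \<open>u\<close> the set \<open>C\<close> of vertices whose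
  walls lie behind that of \<open>u\<close> is closed under adjacency. Hence conjugating \<open>C\<close> by \<open>u\<close> is a
  well-defined partial conjugation, and it brings the walls of \<open>C\<close> closer to \<open>1\<close>.
\<close>

lemma (in racg_walls) partial_conjugation_decreases:
  fixes \<Phi> :: "'b graph"
  assumes \<Phi>: "finite_simplicial_graph \<Phi>"
    and \<sigma>: "\<sigma> \<in> mon (racg \<Phi>) W" and refl: "\<And>x. x \<in> verts \<Phi> \<Longrightarrow> refl (\<sigma> (gen \<Phi> x))"
    and uw: "u \<in> verts \<Phi>" "w \<in> verts \<Phi>"
    and nc: "\<sigma> (gen \<Phi> u) \<otimes>\<^bsub>W\<^esub> \<sigma> (gen \<Phi> w) \<noteq> \<sigma> (gen \<Phi> w) \<otimes>\<^bsub>W\<^esub> \<sigma> (gen \<Phi> u)"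
    and beyond: "beyond (\<sigma> (gen \<Phi> u)) (\<sigma> (gen \<Phi> w))"
  shows "\<exists>\<beta>\<in>auto (racg \<Phi>). (\<forall>x\<in>verts \<Phi>. refl (\<sigma> (\<beta> (gen \<Phi> x)))) \<and>
    (\<Sum>x\<in>verts \<Phi>. wall_dist (\<sigma> (\<beta> (gen \<Phi> x)))) < (\<Sum>x\<in>verts \<Phi>. wall_dist (\<sigma> (gen \<Phi> x)))"
proof -
  interpret P: group "racg \<Phi>" by (rule group_racg)
  have hom: "\<sigma> \<in> hom (racg \<Phi>) W" and inj: "inj_on \<sigma> (carrier (racg \<Phi>))"
    using \<sigma> by (auto simp: mon_def)
  define r where "r x = \<sigma> (gen \<Phi> x)" for x
  have r: "refl (r x)" "r x \<in> carrier W" if "x \<in> verts \<Phi>" for x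
    using refl[OF that] refl_closed by (auto simp: r_def)
  have r_eq: "r x = r y \<longleftrightarrow> x = y" if "x \<in> verts \<Phi>" "y \<in> verts \<Phi>" for x y
    using that inj by (simp add: r_def inj_on_eq_iff gen_eq_iff)
  have r_comm: "r x \<otimes>\<^bsub>W\<^esub> r y = r y \<otimes>\<^bsub>W\<^esub> r x \<longleftrightarrow> x = y \<or> {x, y} \<in> edges \<Phi>"
    if "x \<in> verts \<Phi>" "y \<in> verts \<Phi>" for x y
  proof -
    have "r x \<otimes>\<^bsub>W\<^esub> r y = r y \<otimes>\<^bsub>W\<^esub> r x \<longleftrightarrow>
        \<sigma> (gen \<Phi> x \<otimes>\<^bsub>racg \<Phi>\<^esub> gen \<Phi> y) = \<sigma> (gen \<Phi> y \<otimes>\<^bsub>racg \<Phi>\<^esub> gen \<Phi> x)"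
      using that hom by (simp add: r_def hom_mult)
    then show ?thesis
      using that inj by (simp add: inj_on_eq_iff gen_commute_iff)
  qed
  \<comment> \<open>This may comprise several components of the complement of the star of
    \<open>u\<close>, not only that of \<open>w\<close>.\<close>
  define C where "C = {x \<in> verts \<Phi>. x \<noteq> u \<and> {u, x} \<notin> edges \<Phi> \<and> beyond (r u) (r x)}"
  have w: "w \<in> C"
    using uw nc beyond r_comm[of u w] by (auto simp: C_def r_def)
  have C_edge: "y \<in> C \<or> {u, y} \<in> edges \<Phi>" if "x \<in> C" "y \<in> verts \<Phi>" "{x, y} \<in> edges \<Phi>" "x \<noteq> y" for x y
  proof (rule ccontr)
    assume contra: "\<not> ?thesis"
    have x: "x \<in> verts \<Phi>" "x \<noteq> u" "{u, x} \<notin> edges \<Phi>" "beyond (r u) (r x)"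
      using that unfolding C_def by auto
    have "y \<noteq> u"
      using that(3) x(3) by (auto simp: insert_commute)
    then have "r u \<otimes>\<^bsub>W\<^esub> r y \<noteq> r y \<otimes>\<^bsub>W\<^esub> r u"
      using contra r_comm[of u y] uw that by auto
    then have "beyond (r u) (r y)"
      using beyond_transfer[of "r x" "r y" "r u"] r x that uw r_eq r_comm by auto
    then show False
      using contra \<open>y \<noteq> u\<close> that unfolding C_def by auto
  qed
  define f where "f x = (if x \<in> C then P.conjugate (gen \<Phi> u) (gen \<Phi> x) else gen \<Phi> x)" for x
  have "u \<notin> C" by (simp add: C_def)
  have conj_invol: "P.conjugate (gen \<Phi> u) (P.conjugate (gen \<Phi> u) x) = x" if "x \<in> carrier (racg \<Phi>)" for x
    using uw that by (simp add: P.conjugate_conj)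
  have conj_fix: "P.conjugate (gen \<Phi> u) (gen \<Phi> x) = gen \<Phi> x" if "x \<in> verts \<Phi>" "{u, x} \<in> edges \<Phi>" for x
    using that uw gen_commute[of u \<Phi> x] by (simp add: P.conjugate_eq_self_iff)
  have ne: "x \<noteq> y" if "{x, y} \<in> edges \<Phi>" for x y
    using \<Phi> that unfolding finite_simplicial_graph_def simplicial_graph_def
    by (auto simp: doubleton_eq_iff)
  have "\<exists>\<beta>\<in>auto (racg \<Phi>). \<forall>x\<in>verts \<Phi>. \<beta> (gen \<Phi> x) = f x"
  proof (rule racg_involutive_auto)
    fix x assume x: "x \<in> verts \<Phi>"
    show "f x \<in> carrier (racg \<Phi>)" "f x \<otimes>\<^bsub>racg \<Phi>\<^esub> f x = \<one>\<^bsub>racg \<Phi>\<^esub>"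
      using x uw by (simp_all add: f_def flip: P.conjugate_mult)
    fix y assume y: "y \<in> verts \<Phi>" "{x, y} \<in> edges \<Phi>"
    \<comment> \<open>An edge meeting \<open>C\<close> has each endpoint in \<open>C\<close> or
      adjacent to \<open>u\<close>. On both kinds of vertices \<open>f\<close> is conjugation by
      \<open>gen \<Phi> u\<close>, so the relation of the edge is preserved.\<close>
    have f_conj: "f z = P.conjugate (gen \<Phi> u) (gen \<Phi> z)" if "z \<in> verts \<Phi>" "z \<in> C \<or> {u, z} \<in> edges \<Phi>" for z
      using that conj_fix by (auto simp: f_def)
    show "f x \<otimes>\<^bsub>racg \<Phi>\<^esub> f y = f y \<otimes>\<^bsub>racg \<Phi>\<^esub> f x"
    proof (cases "x \<in> C \<or> y \<in> C")
      case True
      have "{y, x} \<in> edges \<Phi>"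
        using y by (simp add: insert_commute)
      then have "f x = P.conjugate (gen \<Phi> u) (gen \<Phi> x)" "f y = P.conjugate (gen \<Phi> u) (gen \<Phi> y)"
        using True C_edge[of x y] C_edge[of y x] ne[OF y(2)] x y f_conj by blast+
      then show ?thesis
        using x y uw gen_commute by (simp add: P.conjugate_commute_iff)
    next
      case False
      then show ?thesis using x y gen_commute by (metis f_def)
    qed
  next
    fix h x
    assume h: "h \<in> hom (racg \<Phi>) (racg \<Phi>)" "\<And>v. v \<in> verts \<Phi> \<Longrightarrow> h (gen \<Phi> v) = f v"
      and x: "x \<in> verts \<Phi>"
    show "h (f x) = gen \<Phi> x"
    proof (cases "x \<in> C")
      case True
      then have "h (f x) = P.conjugate (h (gen \<Phi> u)) (h (gen \<Phi> x))"
        using hom_conj[OF group_racg group_racg h(1)] uw x by (simp add: f_def)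
      also have "\<dots> = P.conjugate (gen \<Phi> u) (P.conjugate (gen \<Phi> u) (gen \<Phi> x))"
        using h uw x True \<open>u \<notin> C\<close> by (simp add: f_def)
      finally show ?thesis
        using conj_invol x by simp
    qed (use h x in \<open>simp add: f_def\<close>)
  qed
  then obtain \<beta> where \<beta>: "\<beta> \<in> auto (racg \<Phi>)" "\<And>x. x \<in> verts \<Phi> \<Longrightarrow> \<beta> (gen \<Phi> x) = f x"
    by blast
  have image: "\<sigma> (f x) = (if x \<in> C then conjugate (r u) (r x) else r x)" if "x \<in> verts \<Phi>" for x
    using hom_conj[OF group_racg group_racg hom] uw that by (simp add: f_def r_def)
  have less: "wall_dist (\<sigma> (f x)) < wall_dist (r x)" if "x \<in> C" for x
    using image[of x] wall_dist_conj_less[of "r x" "r u"] that r uw unfolding C_def by simp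
  have "(\<Sum>x\<in>verts \<Phi>. wall_dist (\<sigma> (f x))) < (\<Sum>x\<in>verts \<Phi>. wall_dist (r x))"
  proof (rule sum_strict_mono_ex1)
    show "finite (verts \<Phi>)"
      using \<Phi> by (simp add: finite_simplicial_graph_def)
    show "\<forall>x\<in>verts \<Phi>. wall_dist (\<sigma> (f x)) \<le> wall_dist (r x)"
      using less image by (metis order.refl less_imp_le)
    show "\<exists>x\<in>verts \<Phi>. wall_dist (\<sigma> (f x)) < wall_dist (r x)"
      using less w uw by blast
  qed
  moreover have "refl (\<sigma> (f x))" if "x \<in> verts \<Phi>" for x
    using image r refl_conj that uw by simp
  ultimately show ?thesis
    using \<beta> by (intro bexI[of _ \<beta>]) (simp_all add: r_def)
qed

section \<open>Automorphisms of minimal total wall distance\<close>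

theorem corollary1p7:
  fixes \<Phi> :: "'a graph" and \<Psi> :: "'b graph"
    and \<rho> :: "'a word set \<Rightarrow> 'b word set"
  assumes "finite_simplicial_graph \<Phi>" and "finite_simplicial_graph \<Psi>"
    and "\<rho> \<in> mon (racg \<Phi>) (racg \<Psi>)"
    and "triangle_free \<Psi>"
    and "\<not> (\<exists>v. isolated_vertex \<Phi> v)"
  shows "\<exists>\<alpha> \<in> carrier (AutoGroup (racg \<Phi>)). peripheral_embedding \<Phi> \<Psi> (\<rho> \<circ> \<alpha>)"
proof -
  interpret P: group "racg \<Phi>" by (rule group_racg)
  obtain sep where "wall_system (racg \<Psi>) (gen \<Psi> ` verts \<Psi>) sep"
    by (rule racg_wall_system)
  then interpret racg_walls \<Psi> sep
    by (rule racg_walls.intro)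
  define good where "good \<alpha> \<longleftrightarrow> \<alpha> \<in> auto (racg \<Phi>) \<and> (\<forall>x\<in>verts \<Phi>. refl (\<rho> (\<alpha> (gen \<Phi> x))))" for \<alpha>
  define cost where "cost \<alpha> = (\<Sum>x\<in>verts \<Phi>. wall_dist (\<rho> (\<alpha> (gen \<Phi> x))))" for \<alpha>
  have "\<exists>\<alpha>. good \<alpha>"
    using generators_to_reflections[OF assms(3) triangle_free_two_dimensional[OF assms(4)] _ assms(5)]
      assms(1) unfolding good_def finite_simplicial_graph_def by blast
  then obtain \<alpha> where \<alpha>: "good \<alpha>" and minimal: "\<And>\<beta>. good \<beta> \<Longrightarrow> cost \<alpha> \<le> cost \<beta>"
    using ex_has_least_nat[of good _ cost] by blast
  have auto: "\<alpha> \<in> hom (racg \<Phi>) (racg \<Phi>)" "bij_betw \<alpha> (carrier (racg \<Phi>)) (carrier (racg \<Phi>))"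
    using \<alpha> by (auto simp: good_def auto_def Bij_def)
  have \<sigma>: "\<rho> \<circ> \<alpha> \<in> mon (racg \<Phi>) (racg \<Psi>)"
    using assms(3) auto Group.hom_compose[OF auto(1)] unfolding mon_def
    by (auto simp: bij_betw_def intro!: comp_inj_on)
  have refl: "refl ((\<rho> \<circ> \<alpha>) (gen \<Phi> x))" if "x \<in> verts \<Phi>" for x
    using \<alpha> that by (simp add: good_def)
  have "\<not> separates_from_one \<Psi> J K"
    if u: "u \<in> verts \<Phi>" "reflection_along \<Psi> ((\<rho> \<circ> \<alpha>) (gen \<Phi> u)) J"
      and w: "w \<in> verts \<Phi>" "reflection_along \<Psi> ((\<rho> \<circ> \<alpha>) (gen \<Phi> w)) K" for u w J K
  proof
    assume "separates_from_one \<Psi> J K"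
    from separates_beyond[OF u(2) w(2) this] obtain \<beta> where \<beta>: "\<beta> \<in> auto (racg \<Phi>)"
        "\<And>x. x \<in> verts \<Phi> \<Longrightarrow> refl ((\<rho> \<circ> \<alpha>) (\<beta> (gen \<Phi> x)))"
        "(\<Sum>x\<in>verts \<Phi>. wall_dist ((\<rho> \<circ> \<alpha>) (\<beta> (gen \<Phi> x)))) < cost \<alpha>"
      using partial_conjugation_decreases[OF assms(1) \<sigma> refl u(1) w(1)] unfolding cost_def by auto
    \<comment> \<open>The partial conjugation is applied before \<open>\<alpha>\<close>, so the new
      embedding is \<open>\<rho> \<circ> \<alpha> \<circ> \<beta>\<close> on the carrier;
      \<open>compose\<close> keeps the automorphism extensional.\<close>
    have "good (compose (carrier (racg \<Phi>)) \<alpha> \<beta>)"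
      using P.compose_auto \<alpha> \<beta> by (simp add: good_def compose_def)
    then show False
      using minimal[of "compose (carrier (racg \<Phi>)) \<alpha> \<beta>"] \<beta>(3) by (simp add: cost_def compose_def)
  qed
  then have "peripheral \<Psi> {J. \<exists>u\<in>verts \<Phi>. reflection_along \<Psi> ((\<rho> \<circ> \<alpha>) (gen \<Phi> u)) J}"
    using reflection_along_iff unfolding peripheral_def by blast
  moreover have "inj_on (\<lambda>u. (\<rho> \<circ> \<alpha>) (gen \<Phi> u)) (verts \<Phi>)"
  proof (rule inj_onI)
    fix x y
    assume "x \<in> verts \<Phi>" "y \<in> verts \<Phi>" "(\<rho> \<circ> \<alpha>) (gen \<Phi> x) = (\<rho> \<circ> \<alpha>) (gen \<Phi> y)"
    moreover have "inj_on (\<rho> \<circ> \<alpha>) (carrier (racg \<Phi>))"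
      using \<sigma> by (simp add: mon_def)
    ultimately show "x = y"
      using inj_onD[of "\<rho> \<circ> \<alpha>" "carrier (racg \<Phi>)" "gen \<Phi> x" "gen \<Phi> y"] by (simp add: gen_eq_iff)
  qed
  ultimately have "peripheral_embedding \<Phi> \<Psi> (\<rho> \<circ> \<alpha>)"
    unfolding peripheral_embedding_def using \<sigma> refl by (simp add: mon_def reflection_iff)
  moreover have "\<alpha> \<in> carrier (AutoGroup (racg \<Phi>))"
    using \<alpha> by (simp add: good_def AutoGroup_def)
  ultimately show ?thesis by blast
qed

end
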